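(* Let $g_1,\dots,g_m\in\mathbb{R}[x]=\mathbb{R}[x_1,\dots,x_n]$ and suppose $S=\{x\in\mathbb{R}^n:\ g_1(x)\ge 0,\dots,g_m(x)\ge 0\}$ is compact, convex and has nonempty interior. Assume each $g_i$ is concave on $S$. If the positive definite Lagrange Hessian (PDLH) condition holds, then $S$ is SDP representable.
   Context: SDP representable: a set $S\subseteq\mathbb{R}^n$ is SDP representable if there exist an integer $N\ge 0$ and real symmetric matrices $F_0,F_1,\dots,F_n,G_1,\dots,G_N$ of a common size such that $S=\{x\in\mathbb{R}^n:\ \exists\, y\in\mathbb{R}^N,\ F_0+\sum_{i=1}^n x_iF_i+\sum_{j=1}^N y_jG_j\succeq 0\}$. Here $X\succeq 0$ ($X\succ0$) means $X$ is positive semidefinite (positive definite). PDLH condition: for every nonzero $\ell\in\mathbb{R}^n$, for every minimizer $u$ of $\ell^Tx$ over $S$ and corresponding Lagrange multipliers $\lambda_1,\dots,\lambda_m\ge 0$ (i.e. $\ell=\sum_{i=1}^m\lambda_i\nabla g_i(u)$ and $\lambda_ig_i(u)=0$ for all $i$), the matrix $-\sum_{i=1}^m\lambda_i\nabla^2g_i(u)$ is positive definite. *)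

theory Defs
  imports "HOL-Analysis.Analysis" "Jordan_Normal_Form.Matrix"
begin

text \<open>Both imported libraries use the infix symbols for the inner product and for the components
  of a vector. Below, matrices of type \<^typ>\<open>real mat\<close>, whose size is a number rather
  than a type, serve for linear matrix inequalities (the size is quantified existentially);
  points, gradients and Hessians live in \<^typ>\<open>real ^ 'n\<close> and \<^typ>\<open>real ^ 'n ^ 'n\<close>.\<close>

definition pos_semidef_mat :: "real mat \<Rightarrow> bool" where
  "pos_semidef_mat A \<longleftrightarrow> square_mat A \<and> transpose_mat A = A \<and>
     (\<forall>v \<in> carrier_vec (dim_row A). 0 \<le> scalar_prod v (mult_mat_vec A v))"

definition sym_mat :: "nat \<Rightarrow> real mat \<Rightarrow> bool" where
  "sym_mat d A \<longleftrightarrow> A \<in> carrier_mat d d \<and> transpose_mat A = A"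

text \<open>The matrix $F_0 + \sum_i x_i F_i + \sum_{j=1}^N y_j G_j$ of size $d$, written entrywise
  because matrices of unspecified size have no additive monoid instance. Only the values of
  \<^term>\<open>y\<close> on $\{1,\dots,N\}$ matter.\<close>

definition linear_pencil ::
  "nat \<Rightarrow> nat \<Rightarrow> real mat \<Rightarrow> ('n::finite \<Rightarrow> real mat) \<Rightarrow> (nat \<Rightarrow> real mat) \<Rightarrow>
    real ^ 'n \<Rightarrow> (nat \<Rightarrow> real) \<Rightarrow> real mat" where
  "linear_pencil d N F0 F G x y = Matrix.mat d d (\<lambda>(r, c).
     F0 $$ (r, c) + (\<Sum>i\<in>UNIV. vec_nth x i * F i $$ (r, c)) + (\<Sum>j=1..N. y j * G j $$ (r, c)))"

definition SDP_representable :: "(real ^ 'n::finite) set \<Rightarrow> bool" where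
  "SDP_representable S \<longleftrightarrow>
     (\<exists>N d F0 F G.
        sym_mat d F0 \<and> (\<forall>i. sym_mat d (F i)) \<and> (\<forall>j\<in>{1..N}. sym_mat d (G j)) \<and>
        S = {x. \<exists>y. pos_semidef_mat (linear_pencil d N F0 F G x y)})"

definition partial_deriv :: "'n \<Rightarrow> (real ^ 'n::finite \<Rightarrow> real) \<Rightarrow> real ^ 'n \<Rightarrow> real" where
  "partial_deriv i f x = deriv (\<lambda>t. f (x + t *\<^sub>R axis i 1)) 0"

definition gradient :: "(real ^ 'n::finite \<Rightarrow> real) \<Rightarrow> real ^ 'n \<Rightarrow> real ^ 'n" where
  "gradient f x = (\<chi> i. partial_deriv i f x)"

definition hessian :: "(real ^ 'n::finite \<Rightarrow> real) \<Rightarrow> real ^ 'n \<Rightarrow> real ^ 'n ^ 'n" where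
  "hessian f x = (\<chi> i j. partial_deriv i (partial_deriv j f) x)"

definition pos_def :: "real ^ 'n ^ 'n::finite \<Rightarrow> bool" where
  "pos_def A \<longleftrightarrow> transpose A = A \<and> (\<forall>v. v \<noteq> 0 \<longrightarrow> 0 < inner v (A *v v))"

definition semialg_set :: "nat \<Rightarrow> (nat \<Rightarrow> real ^ 'n::finite \<Rightarrow> real) \<Rightarrow> (real ^ 'n) set" where
  "semialg_set m g = {x. \<forall>i\<in>{1..m}. 0 \<le> g i x}"

definition lagrange_multipliers ::
  "nat \<Rightarrow> (nat \<Rightarrow> real ^ 'n::finite \<Rightarrow> real) \<Rightarrow> real ^ 'n \<Rightarrow> real ^ 'n \<Rightarrow> (nat \<Rightarrow> real) \<Rightarrow> bool" where
  "lagrange_multipliers m g l u \<mu> \<longleftrightarrow>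
     (\<forall>i\<in>{1..m}. 0 \<le> \<mu> i) \<and>
     l = (\<Sum>i=1..m. \<mu> i *\<^sub>R gradient (g i) u) \<and>
     (\<forall>i\<in>{1..m}. \<mu> i * g i u = 0)"

definition PDLH :: "nat \<Rightarrow> (nat \<Rightarrow> real ^ 'n::finite \<Rightarrow> real) \<Rightarrow> bool" where
  "PDLH m g \<longleftrightarrow>
     (\<forall>l u \<mu>. l \<noteq> 0 \<longrightarrow>
        is_arg_min (\<lambda>x. inner l x) (\<lambda>x. x \<in> semialg_set m g) u \<longrightarrow>
        lagrange_multipliers m g l u \<mu> \<longrightarrow>
        pos_def (- (\<Sum>i=1..m. \<mu> i *\<^sub>R hessian (g i) u)))"

end

theory Submission
  imports Defs
begin

text \<open>For a minimizer \<open>u\<close> of \<open>\<ell>\<close> over \<open>S\<close> with multipliers \<open>\<mu>\<close>, Taylor's formula gives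
  \[ \ell\cdot(x-u) = \sum_i \mu_i g_i(x) + (x-u)^T F_{u,\mu}(x)\,(x-u), \qquad
     F_{u,\mu}(x) = -\int_0^1 (1-s) \sum_i \mu_i \nabla^2 g_i(u+s(x-u))\,ds . \]
  By concavity and PDLH, \<open>F\<close> is positive definite on \<open>S\<close>, and uniformly so because the pairs
  \<open>(u, \<mu>)\<close> with \<open>|\<ell>| = 1\<close> form a compact set by Slater's condition. The \<open>F\<close>'s lie in a
  finite-dimensional space of polynomial matrices, hence in a cone generated by finitely many
  matrices \<open>P_j\<close> that are positive semidefinite on \<open>S\<close>; no Positivstellensatz is needed, since
  the \<open>P_j\<close> need not be sums of squares. A linear functional \<open>L\<close> on functions with \<open>L(1) = 1\<close> and
  \<open>L(x) = x_0\<close> that satisfies \<open>L(g_i) \<ge> 0\<close> and \<open>L((t x - w)^T P_j(x) (t x - w)) \<ge> 0\<close> for all \<open>t, w\<close>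
  (a linear matrix inequality in \<open>L\<close>) then satisfies \<open>\<ell>\<cdot>x_0 \<ge> \<ell>\<cdot>u\<close> for every such \<open>\<ell>\<close>, so that
  \<open>x_0 \<in> S\<close>; conversely evaluation at a point of \<open>S\<close> is such a functional.\<close>

subsection \<open>Derivatives of polynomial functions\<close>

text \<open>Induction over the polynomial. \<open>partial_deriv\<close> is defined through
  \<open>deriv\<close> and says nothing until differentiability is known, so some polynomial
  partials \<open>D\<close> are produced first; the next lemma identifies
  \<open>partial_deriv\<close> with them.\<close>

lemma real_polynomial_function_derivative_ex:
  fixes f :: "real ^ 'n::finite \<Rightarrow> real"
  assumes "real_polynomial_function f"
  shows "\<exists>D. (\<forall>i. real_polynomial_function (D i)) \<and>
    (\<forall>x. (f has_derivative (\<lambda>v. \<Sum>i\<in>UNIV. vec_nth v i * D i x)) (at x))"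
  using assms
proof induction
  case (linear f)
  have "f v = (\<Sum>i\<in>UNIV. vec_nth v i * f (axis i 1))" for v
  proof -
    have "f v = f (\<Sum>i\<in>UNIV. vec_nth v i *\<^sub>R axis i 1)"
      using basis_expansion[of v] by (simp add: scalar_mult_eq_scaleR)
    also have "\<dots> = (\<Sum>i\<in>UNIV. vec_nth v i * f (axis i 1))"
      using linear by (simp add: linear_sum bounded_linear.linear linear_scale)
    finally show ?thesis .
  qed
  then have "(\<lambda>v. \<Sum>i\<in>UNIV. vec_nth v i * f (axis i 1)) = f"
    by (intro ext) (rule sym)
  moreover have "(f has_derivative f) (at x)" for x
    using linear by (rule bounded_linear_imp_has_derivative)
  ultimately have "(f has_derivative (\<lambda>v. \<Sum>i\<in>UNIV. vec_nth v i * f (axis i 1))) (at x)" for x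
    by (simp only:)
  then show ?case
    by (intro exI[of _ "\<lambda>i x. f (axis i 1)"]) (simp add: real_polynomial_function.intros)
next
  case (const c)
  show ?case
    by (intro exI[of _ "\<lambda>i x. 0"]) (auto intro: real_polynomial_function.intros)
next
  case (add f g)
  obtain D where "\<And>i. real_polynomial_function (D i)"
    and D: "\<And>x. (f has_derivative (\<lambda>v. \<Sum>i\<in>UNIV. vec_nth v i * D i x)) (at x)"
    using add.IH(1) by blast
  moreover obtain E where "\<And>i. real_polynomial_function (E i)"
    and E: "\<And>x. (g has_derivative (\<lambda>v. \<Sum>i\<in>UNIV. vec_nth v i * E i x)) (at x)"
    using add.IH(2) by blast
  moreover have "((\<lambda>x. f x + g x) has_derivative (\<lambda>v. \<Sum>i\<in>UNIV. vec_nth v i * (D i x + E i x))) (at x)" for x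
    using has_derivative_add[OF D[of x] E[of x]] by (simp add: sum.distrib algebra_simps)
  ultimately show ?case
    by (intro exI[of _ "\<lambda>i x. D i x + E i x"]) (auto intro: real_polynomial_function.intros)
next
  case (mult f g)
  obtain D where "\<And>i. real_polynomial_function (D i)"
    and D: "\<And>x. (f has_derivative (\<lambda>v. \<Sum>i\<in>UNIV. vec_nth v i * D i x)) (at x)"
    using mult.IH(1) by blast
  moreover obtain E where "\<And>i. real_polynomial_function (E i)"
    and E: "\<And>x. (g has_derivative (\<lambda>v. \<Sum>i\<in>UNIV. vec_nth v i * E i x)) (at x)"
    using mult.IH(2) by blast
  moreover have "((\<lambda>x. f x * g x) has_derivative
      (\<lambda>v. \<Sum>i\<in>UNIV. vec_nth v i * (f x * E i x + D i x * g x))) (at x)" for x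
    using has_derivative_mult[OF D[of x] E[of x]]
    by (simp add: sum.distrib sum_distrib_left sum_distrib_right algebra_simps)
  ultimately show ?case using mult.hyps
    by (intro exI[of _ "\<lambda>i x. f x * E i x + D i x * g x"])
      (auto intro!: real_polynomial_function.intros(3,4))
qed

lemma partial_deriv_real_polynomial_function:
  fixes f :: "real ^ 'n::finite \<Rightarrow> real"
  assumes "real_polynomial_function f"
  shows real_polynomial_function_partial_deriv: "real_polynomial_function (partial_deriv i f)"
    and has_derivative_gradient: "(f has_derivative (\<lambda>v. inner (gradient f x) v)) (at x)"
proof -
  obtain D where D: "\<And>i. real_polynomial_function (D i)"
    and d: "\<And>x. (f has_derivative (\<lambda>v. \<Sum>i\<in>UNIV. vec_nth v i * D i x)) (at x)"
    using real_polynomial_function_derivative_ex[OF assms] by blast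
  have eq: "partial_deriv i f x = D i x" for i x
  proof -
    have "((\<lambda>t. x + t *\<^sub>R axis i (1::real)) has_derivative (\<lambda>t. t *\<^sub>R axis i 1)) (at 0)"
      by (auto intro!: derivative_eq_intros)
    then have "((\<lambda>t. f (x + t *\<^sub>R axis i 1)) has_derivative
        (\<lambda>t. \<Sum>j\<in>UNIV. vec_nth (t *\<^sub>R axis i 1) j * D j x)) (at 0)"
      using has_derivative_compose[where g = f, OF _ d] by fastforce
    moreover have "(\<Sum>j\<in>UNIV. vec_nth (t *\<^sub>R axis i 1) j * D j x) = D i x * t" for t
      by (simp add: axis_def if_distrib if_distribR cong: if_cong)
    ultimately have "((\<lambda>t. f (x + t *\<^sub>R axis i 1)) has_real_derivative D i x) (at 0)"
      by (simp add: has_field_derivative_def)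
    then show ?thesis
      by (simp add: partial_deriv_def DERIV_imp_deriv)
  qed
  then have "partial_deriv i f = D i" for i by auto
  then show "real_polynomial_function (partial_deriv i f)" using D by simp
  have "(\<lambda>v. \<Sum>i\<in>UNIV. vec_nth v i * D i x) = (\<lambda>v. inner (gradient f x) v)"
    by (simp add: inner_vec_def gradient_def eq mult.commute)
  then show "(f has_derivative (\<lambda>v. inner (gradient f x) v)) (at x)"
    using d[of x] by simp
qed

lemma DERIV_line_gradient:
  fixes f :: "real ^ 'n::finite \<Rightarrow> real"
  assumes "real_polynomial_function f"
  shows "((\<lambda>s. f (u + s *\<^sub>R w)) has_real_derivative inner (gradient f (u + s *\<^sub>R w)) w) (at s within T)"
proof -
  have "((\<lambda>s. u + s *\<^sub>R w) has_derivative (\<lambda>t. t *\<^sub>R w)) (at s within T)"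
    by (auto intro!: derivative_eq_intros)
  from has_derivative_compose[OF this has_derivative_gradient[OF assms]]
  show ?thesis
    by (simp add: has_field_derivative_def mult.commute[of _ "inner _ _"])
qed

lemma inner_hessian_eq_sum:
  "inner w (hessian f x *v w) =
    (\<Sum>i\<in>UNIV. \<Sum>j\<in>UNIV. vec_nth w i * vec_nth w j * partial_deriv i (partial_deriv j f) x)"
  by (simp add: inner_vec_def matrix_vector_mult_def hessian_def sum_distrib_left mult_ac)

lemma DERIV_line_hessian:
  fixes f :: "real ^ 'n::finite \<Rightarrow> real"
  assumes "real_polynomial_function f"
  shows "((\<lambda>s. inner (gradient f (u + s *\<^sub>R w)) w) has_real_derivative
    inner w (hessian f (u + s *\<^sub>R w) *v w)) (at s within T)"
proof -
  have "((\<lambda>s. \<Sum>j\<in>UNIV. vec_nth w j * partial_deriv j f (u + s *\<^sub>R w)) has_real_derivative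
      (\<Sum>j\<in>UNIV. vec_nth w j * inner (gradient (partial_deriv j f) (u + s *\<^sub>R w)) w)) (at s within T)"
    by (intro DERIV_sum DERIV_cmult DERIV_line_gradient
        real_polynomial_function_partial_deriv assms)
  moreover have "(\<Sum>j\<in>UNIV. vec_nth w j * partial_deriv j f y) = inner (gradient f y) w" for y
    by (simp add: inner_vec_def gradient_def mult.commute)
  moreover have "(\<Sum>j\<in>UNIV. vec_nth w j * inner (gradient (partial_deriv j f) y) w)
      = inner w (hessian f y *v w)" for y
    unfolding inner_hessian_eq_sum
    by (subst sum.swap) (simp add: inner_vec_def gradient_def sum_distrib_left mult_ac)
  ultimately show ?thesis by simp
qed

section \<open>Concave polynomials: tangent inequality, Hessian and Taylor remainder\<close>

lemma continuous_on_real_polynomial_function: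
  "real_polynomial_function f \<Longrightarrow> continuous_on T f"
  by (simp add: real_polynomial_function_eq continuous_on_polymonial_function)

text \<open>By concavity each difference quotient along the segment from \<open>u\<close> to
  \<open>x\<close> is at least \<open>f x - f u\<close>; the one-sided limit at 0 is the directional
  derivative.\<close>

lemma concave_on_le_tangent:
  fixes f :: "real ^ 'n::finite \<Rightarrow> real"
  assumes f: "real_polynomial_function f" and conc: "concave_on S f" and u: "u \<in> S" and x: "x \<in> S"
  shows "f x \<le> f u + inner (gradient f u) (x - u)"
proof -
  have "((\<lambda>s. f (u + s *\<^sub>R (x - u))) has_real_derivative inner (gradient f u) (x - u)) (at 0)"
    using DERIV_line_gradient[OF f, of u "x - u" 0 UNIV] by simp
  then have "(\<lambda>s. (f (u + s *\<^sub>R (x - u)) - f u) / s) \<midarrow>0\<rightarrow> inner (gradient f u) (x - u)"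
    by (simp add: DERIV_def)
  then have lim: "((\<lambda>s. (f (u + s *\<^sub>R (x - u)) - f u) / s) \<longlongrightarrow> inner (gradient f u) (x - u)) (at_right 0)"
    by (rule filterlim_mono) (auto simp: at_le)
  have "eventually (\<lambda>s::real. f x - f u \<le> (f (u + s *\<^sub>R (x - u)) - f u) / s) (at_right 0)"
    unfolding eventually_at_right_field
  proof (intro exI[of _ 1] conjI allI impI)
    fix s :: real assume s: "0 < s" "s < 1"
    have "(1 - s) * f u + s * f x \<le> f ((1 - s) *\<^sub>R u + s *\<^sub>R x)"
      using conc u x s unfolding concave_on_iff by force
    moreover have "(1 - s) *\<^sub>R u + s *\<^sub>R x = u + s *\<^sub>R (x - u)"
      by (simp add: algebra_simps)
    ultimately show "f x - f u \<le> (f (u + s *\<^sub>R (x - u)) - f u) / s"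
      using s by (simp add: field_simps)
  qed auto
  from tendsto_lowerbound[OF lim this] show ?thesis by simp
qed

lemma continuous_on_inner_hessian:
  assumes "real_polynomial_function f"
  shows "continuous_on T (\<lambda>x. inner w (hessian f x *v w))"
  unfolding inner_hessian_eq_sum
  by (intro continuous_intros continuous_on_real_polynomial_function
      real_polynomial_function_partial_deriv assms)

lemma interior_contains_segment_start:
  fixes x d :: "'a::real_normed_vector"
  assumes "x \<in> interior S"
  obtains e :: real where "e > 0" "\<And>t. 0 < t \<Longrightarrow> t < e \<Longrightarrow> x + t *\<^sub>R d \<in> interior S"
proof -
  have "((\<lambda>t. x + t *\<^sub>R d) \<longlongrightarrow> x + 0 *\<^sub>R d) (at_right 0)"
    by (intro tendsto_intros)
  then have "eventually (\<lambda>t. x + t *\<^sub>R d \<in> interior S) (at_right 0)"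
    using assms by (intro topological_tendstoD[where l = x]) auto
  then show thesis
    using that unfolding eventually_at_right_field by auto
qed

text \<open>At interior points, adding the tangent inequalities at \<open>x\<close> and
  \<open>x + h w\<close> shows that the slope along \<open>w\<close> does not increase, whereas a
  positive second derivative would make it increase.\<close>

lemma concave_on_hessian_nonpos:
  fixes f :: "real ^ 'n::finite \<Rightarrow> real"
  assumes f: "real_polynomial_function f" and conc: "concave_on S f"
    and ne: "interior S \<noteq> {}" and u: "u \<in> S"
  shows "inner w (hessian f u *v w) \<le> 0"
proof -
  have int: "inner w (hessian f x *v w) \<le> 0" if x: "x \<in> interior S" for x
  proof (rule ccontr)
    assume "\<not> ?thesis"
    then have pos: "0 < inner w (hessian f (x + 0 *\<^sub>R w) *v w)" by simp
    obtain d where d: "d > 0" "\<And>h. 0 < h \<Longrightarrow> h < d \<Longrightarrow>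
        inner (gradient f x) w < inner (gradient f (x + h *\<^sub>R w)) w"
      using DERIV_pos_inc_right[OF DERIV_line_hessian[OF f] pos] by auto
    obtain e where e: "e > 0" "\<And>h. 0 < h \<Longrightarrow> h < e \<Longrightarrow> x + h *\<^sub>R w \<in> interior S"
      using interior_contains_segment_start[OF x] by blast
    define h where "h = min d e / 2"
    have h: "0 < h" "h < d" "h < e" using d(1) e(1) by (auto simp: h_def)
    have hS: "x + h *\<^sub>R w \<in> S" using e(2)[OF h(1,3)] interior_subset by blast
    have xS: "x \<in> S" using x interior_subset by blast
    have "f (x + h *\<^sub>R w) \<le> f x + h * inner (gradient f x) w"
      using concave_on_le_tangent[OF f conc xS hS] by simp
    moreover have "f x \<le> f (x + h *\<^sub>R w) - h * inner (gradient f (x + h *\<^sub>R w)) w"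
      using concave_on_le_tangent[OF f conc hS xS] by (simp add: inner_diff_right)
    ultimately have "h * inner (gradient f (x + h *\<^sub>R w)) w \<le> h * inner (gradient f x) w"
      by linarith
    then show False using d(2)[OF h(1,2)] h(1) by simp
  qed
  \<comment> \<open>From a boundary point one cannot move freely; there the sign comes by
    continuity, since a convex set with nonempty interior lies in the closure of its
    interior.\<close>
  have "convex S" using conc by (simp add: concave_on_def convex_on_def)
  have "closed {x. inner w (hessian f x *v w) \<le> 0}"
    by (intro closed_Collect_le continuous_on_inner_hessian f continuous_intros)
  then have "closure (interior S) \<subseteq> {x. inner w (hessian f x *v w) \<le> 0}"
    using int by (intro closure_minimal) auto
  then show ?thesis
    using convex_closure_interior[OF \<open>convex S\<close> ne] closure_subset u by blast
qed

lemma taylor_integral_remainder: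
  fixes f :: "real ^ 'n::finite \<Rightarrow> real"
  assumes f: "real_polynomial_function f"
  shows "((\<lambda>s. (1 - s) * inner (x - u) (hessian f (u + s *\<^sub>R (x - u)) *v (x - u))) has_integral
    f x - f u - inner (gradient f u) (x - u)) {0..1}"
proof -
  let ?w = "x - u"
  \<comment> \<open>Integration by parts done beforehand: if \<open>\<phi>\<close> is
    \<open>f\<close> along the segment, then \<open>(1 - s) \<phi>' + \<phi>\<close> is an
    antiderivative of \<open>(1 - s) \<phi>''\<close>.\<close>
  let ?G = "\<lambda>s. (1 - s) * inner (gradient f (u + s *\<^sub>R ?w)) ?w + f (u + s *\<^sub>R ?w)"
  have "(?G has_real_derivative (1 - s) * inner ?w (hessian f (u + s *\<^sub>R ?w) *v ?w)) (at s within {0..1})" for s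
    by (rule derivative_eq_intros DERIV_line_gradient[OF f] DERIV_line_hessian[OF f] refl)+
      (simp add: algebra_simps)
  from fundamental_theorem_of_calculus[where f = ?G, OF _ this[THEN has_real_derivative_iff_has_vector_derivative[THEN iffD1]]]
  show ?thesis by (simp add: algebra_simps)
qed

section \<open>Existence of Lagrange multipliers\<close>

text \<open>The weights belong to indices and not to points, because different constraints may have
  the same gradient at a point.\<close>

lemma convex_hull_image_combination:
  fixes f :: "'i \<Rightarrow> 'a::real_vector"
  assumes "finite A" and "x \<in> convex hull (f ` A)"
  obtains w where "\<And>i. i \<in> A \<Longrightarrow> 0 \<le> w i" "sum w A = 1" "x = (\<Sum>i\<in>A. w i *\<^sub>R f i)"
proof -
  let ?H = "{\<Sum>i\<in>A. w i *\<^sub>R f i | w. (\<forall>i\<in>A. 0 \<le> w i) \<and> sum w A = 1}"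
  have "convex hull (f ` A) \<subseteq> ?H"
  proof (rule hull_minimal)
    show "f ` A \<subseteq> ?H"
    proof
      fix y assume "y \<in> f ` A"
      then obtain j where j: "j \<in> A" "y = f j" by blast
      then have "y = (\<Sum>i\<in>A. (if i = j then 1 else 0) *\<^sub>R f i)"
        using \<open>finite A\<close> by (simp add: if_distrib[of "\<lambda>t. t *\<^sub>R _"] cong: if_cong)
      then show "y \<in> ?H" using j \<open>finite A\<close>
        by (intro CollectI exI[of _ "\<lambda>i. if i = j then 1 else 0"]) auto
    qed
    show "convex ?H"
    proof (rule convexI)
      fix x y and s t :: real
      assume st: "0 \<le> s" "0 \<le> t" "s + t = 1"
      assume "x \<in> ?H" "y \<in> ?H"
      then obtain v w where "\<forall>i\<in>A. 0 \<le> v i" "sum v A = 1" "x = (\<Sum>i\<in>A. v i *\<^sub>R f i)"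
        and "\<forall>i\<in>A. 0 \<le> w i" "sum w A = 1" "y = (\<Sum>i\<in>A. w i *\<^sub>R f i)" by blast
      then show "s *\<^sub>R x + t *\<^sub>R y \<in> ?H" using st
        by (intro CollectI exI[of _ "\<lambda>i. s * v i + t * w i"])
          (simp add: sum.distrib scaleR_add_left scaleR_sum_right flip: sum_distrib_left)
    qed
  qed
  then show thesis using assms(2) that by blast
qed

text \<open>On the line from \<open>x0\<close> through \<open>y\<close> the polynomial becomes
  univariate with infinitely many roots near \<open>x0\<close>; its coefficients vanish, in
  particular its value at parameter 1, which is \<open>f y\<close>.\<close>

lemma real_polynomial_function_eq_0:
  fixes f :: "'a::real_normed_vector \<Rightarrow> real"
  assumes f: "real_polynomial_function f" and x0: "x0 \<in> interior S" and 0: "\<And>x. x \<in> S \<Longrightarrow> f x = 0"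
  shows "f y = 0"
proof -
  have "polynomial_function (\<lambda>t::real. x0 + t *\<^sub>R (y - x0))"
    by (intro polynomial_function_add polynomial_function_const polynomial_function_bounded_linear
        bounded_linear_scaleR_left)
  then have "real_polynomial_function (\<lambda>t. f (x0 + t *\<^sub>R (y - x0)))"
    using real_polynomial_function_compose[OF _ f] by (simp add: o_def)
  then obtain a n where a: "(\<lambda>t. f (x0 + t *\<^sub>R (y - x0))) = (\<lambda>t. \<Sum>i\<le>(n::nat). a i * t ^ i)"
    using real_polynomial_function_iff_sum by metis
  obtain d where d: "d > 0" "\<And>t. 0 < t \<Longrightarrow> t < d \<Longrightarrow> x0 + t *\<^sub>R (y - x0) \<in> interior S"
    using interior_contains_segment_start[OF x0] by blast
  have "(\<Sum>i\<le>n. a i * t ^ i) = 0" if "0 < t" "t < d" for t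
    using fun_cong[OF a, of t] 0[OF subsetD[OF interior_subset d(2)[OF that]]] by simp
  then have "{0<..<d} \<subseteq> {t. (\<Sum>i\<le>n. a i * t ^ i) = 0}" by auto
  then have "infinite {t. (\<Sum>i\<le>n. a i * t ^ i) = 0}"
    using d(1) infinite_Ioo[of 0 d] finite_subset by blast
  then have "\<forall>i\<le>n. a i = 0"
    using polyfun_finite_roots[of a n] by auto
  then show ?thesis using fun_cong[OF a, of 1] by simp
qed

text \<open>Fritz John argument. If 0 is outside the convex hull of \<open>- l\<close> and the
  active gradients, a separating vector is a feasible descent direction, against minimality. So 0 is
  a convex combination of them; the Slater point shows that \<open>- l\<close> has positive weight,
  and dividing by this weight gives the multipliers.\<close>

lemma ex_lagrange_multipliers:
  fixes g :: "'i \<Rightarrow> real ^ 'n::finite \<Rightarrow> real"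
  assumes fin: "finite I" and poly: "\<And>i. i \<in> I \<Longrightarrow> real_polynomial_function (g i)"
    and S: "S = {x. \<forall>i\<in>I. 0 \<le> g i x}" and conc: "\<And>i. i \<in> I \<Longrightarrow> concave_on S (g i)"
    and x0: "x0 \<in> S" "\<And>i. i \<in> I \<Longrightarrow> 0 < g i x0"
    and u: "u \<in> S" "\<And>x. x \<in> S \<Longrightarrow> inner l u \<le> inner l x"
  obtains \<mu> where "\<And>i. i \<in> I \<Longrightarrow> 0 \<le> \<mu> i" "\<And>i. i \<in> I \<Longrightarrow> \<mu> i * g i u = 0"
    "l = (\<Sum>i\<in>I. \<mu> i *\<^sub>R gradient (g i) u)"
proof -
  define J where "J = {i \<in> I. g i u = 0}"
  have J: "finite J" "J \<subseteq> I" using fin by (auto simp: J_def)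
  \<comment> \<open>\<open>None\<close> stands for the objective, \<open>Some i\<close> for the
    active constraint \<open>i\<close>.\<close>
  define f where "f = case_option (- l) (\<lambda>i. gradient (g i) u)"
  define X where "X = f ` (insert None (Some ` J))"
  have "0 \<in> convex hull X"
  proof (rule ccontr)
    assume "0 \<notin> convex hull X"
    moreover have "closed (convex hull X)"
      using J(1) by (simp add: X_def compact_imp_closed finite_imp_compact_convex_hull)
    ultimately obtain d b where d: "0 < b" "\<And>x. x \<in> convex hull X \<Longrightarrow> b < inner d x"
      using separating_hyperplane_closed_0[OF convex_convex_hull] by blast
    have pos: "0 < inner d x" if "x \<in> X" for x
      using d(1) d(2)[OF hull_inc[OF that]] by linarith
    have "0 < inner d (f None)" by (rule pos) (simp add: X_def)
    then have "inner l d < 0"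
      by (simp add: f_def inner_commute)
    have grad: "0 < inner (gradient (g i) u) d" if "i \<in> J" for i
    proof -
      have "0 < inner d (f (Some i))" using that by (intro pos) (simp add: X_def)
      then show ?thesis by (simp add: f_def inner_commute)
    qed
    \<comment> \<open>Active constraints increase along \<open>d\<close> at first order; inactive
      ones stay positive by continuity.\<close>
    have "eventually (\<lambda>t. 0 \<le> g i (u + t *\<^sub>R d)) (at_right 0)" if i: "i \<in> I" for i
    proof (cases "i \<in> J")
      case True
      have "((\<lambda>s. g i (u + s *\<^sub>R d)) has_real_derivative inner (gradient (g i) u) d) (at 0)"
        using DERIV_line_gradient[OF poly[OF i], of u d 0 UNIV] by simp
      from DERIV_pos_inc_right[OF this grad[OF True]]
      obtain e where "e > 0" "\<forall>h>0. h < e \<longrightarrow> g i u < g i (u + h *\<^sub>R d)" by auto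
      then show ?thesis using True unfolding eventually_at_right_field J_def
        by (intro exI[of _ e]) (auto simp: less_imp_le)
    next
      case False
      then have "0 < g i u" using i u(1) S by (auto simp: J_def order_less_le)
      have "isCont (\<lambda>t. g i (u + t *\<^sub>R d)) 0"
        by (rule DERIV_isCont[OF DERIV_line_gradient[OF poly[OF i]]])
      then have "((\<lambda>t. g i (u + t *\<^sub>R d)) \<longlongrightarrow> g i u) (at_right 0)"
        by (simp add: isCont_def filterlim_at_split)
      then have "eventually (\<lambda>t. 0 < g i (u + t *\<^sub>R d)) (at_right 0)"
        using \<open>0 < g i u\<close> by (rule order_tendstoD)
      then show ?thesis by (rule eventually_mono) simp
    qed
    then have "eventually (\<lambda>t. \<forall>i\<in>I. 0 \<le> g i (u + t *\<^sub>R d)) (at_right 0)"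
      using fin by (simp add: eventually_ball_finite)
    then obtain e :: real where "e > 0" "\<And>t. 0 < t \<Longrightarrow> t < e \<Longrightarrow> u + t *\<^sub>R d \<in> S"
      unfolding eventually_at_right_field S by auto
    then have "u + (e / 2) *\<^sub>R d \<in> S" by simp
    from u(2)[OF this] \<open>e > 0\<close> \<open>inner l d < 0\<close> show False
      by (simp add: inner_add_right zero_le_mult_iff)
  qed
  then obtain w where w: "\<And>i. i \<in> insert None (Some ` J) \<Longrightarrow> 0 \<le> w i"
    "sum w (insert None (Some ` J)) = 1" "0 = (\<Sum>i\<in>insert None (Some ` J). w i *\<^sub>R f i)"
    using convex_hull_image_combination[of "insert None (Some ` J)" 0 f] J(1)
    unfolding X_def by auto
  have sum1: "w None + (\<Sum>i\<in>J. w (Some i)) = 1"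
    using w(2) J(1) by (simp add: sum.reindex)
  have sum0: "w None *\<^sub>R l = (\<Sum>i\<in>J. w (Some i) *\<^sub>R gradient (g i) u)"
    using w(3) J(1) by (simp add: sum.reindex f_def)
  have nn: "0 \<le> w None" "\<And>i. i \<in> J \<Longrightarrow> 0 \<le> w (Some i)" using w(1) by auto
  \<comment> \<open>Otherwise the weighted active gradients sum to 0. Pairing this sum with
    \<open>x0 - u\<close> bounds the nonnegative sum of the \<open>w (Some i) * g i x0\<close> by 0,
    so all weights vanish although they sum to 1.\<close>
  have "w None \<noteq> 0"
  proof
    assume 0: "w None = 0"
    have le: "w (Some i) * g i x0 \<le> w (Some i) * inner (gradient (g i) u) (x0 - u)" if "i \<in> J" for i
    proof (rule mult_left_mono)
      have "g i x0 \<le> g i u + inner (gradient (g i) u) (x0 - u)"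
        using that J(2) by (intro concave_on_le_tangent[OF poly conc u(1) x0(1)]) auto
      then show "g i x0 \<le> inner (gradient (g i) u) (x0 - u)"
        using that by (simp add: J_def)
    qed (use nn that in auto)
    have "(\<Sum>i\<in>J. w (Some i) * g i x0) \<le> (\<Sum>i\<in>J. w (Some i) * inner (gradient (g i) u) (x0 - u))"
      using le by (rule sum_mono)
    also have "\<dots> = inner (\<Sum>i\<in>J. w (Some i) *\<^sub>R gradient (g i) u) (x0 - u)"
      by (simp add: inner_sum_left)
    also have "\<dots> = 0" by (simp add: 0 flip: sum0)
    finally have "(\<Sum>i\<in>J. w (Some i) * g i x0) \<le> 0" .
    moreover have "0 \<le> w (Some i) * g i x0" if "i \<in> J" for i
      using nn(2)[OF that] x0(2)[of i] that J(2) by (intro mult_nonneg_nonneg) auto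
    ultimately have "\<forall>i\<in>J. w (Some i) * g i x0 = 0"
      using J(1) by (metis (no_types, lifting) order_antisym sum_nonneg sum_nonneg_eq_0_iff)
    then have "\<forall>i\<in>J. w (Some i) = 0" using x0(2) J(2) by fastforce
    then show False using sum1 0 by simp
  qed
  then have pos: "0 < w None" using nn(1) by simp
  define \<mu> where "\<mu> = (\<lambda>i. if i \<in> J then w (Some i) / w None else 0)"
  show thesis
  proof (rule that[of \<mu>])
    show "0 \<le> \<mu> i" "\<mu> i * g i u = 0" for i
      using nn by (auto simp: \<mu>_def J_def)
    have "l = (1 / w None) *\<^sub>R (w None *\<^sub>R l)" using pos by simp
    also have "\<dots> = (\<Sum>i\<in>J. \<mu> i *\<^sub>R gradient (g i) u)"
      unfolding sum0 by (simp add: \<mu>_def scaleR_sum_right)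
    also have "\<dots> = (\<Sum>i\<in>I. \<mu> i *\<^sub>R gradient (g i) u)"
      using J fin by (intro sum.mono_neutral_left) (auto simp: \<mu>_def)
    finally show "l = (\<Sum>i\<in>I. \<mu> i *\<^sub>R gradient (g i) u)" .
  qed
qed

subsection \<open>Separation of variables in the Taylor remainder\<close>

text \<open>Finite sums of terms in which \<open>s\<close>, \<open>x\<close> and \<open>u\<close>
  occur in different factors. Integrating over \<open>s\<close> then leaves a finite sum of products
  of a function of \<open>u\<close> and a function of \<open>x\<close>, so that the remainders for
  all base points \<open>u\<close> lie in one finite-dimensional space of functions of
  \<open>x\<close>.\<close>

inductive separated :: "(real \<Rightarrow> 'a::topological_space \<Rightarrow> 'b::topological_space \<Rightarrow> real) \<Rightarrow> bool" where
  monomial: "continuous_on UNIV A \<Longrightarrow> continuous_on UNIV c \<Longrightarrow> separated (\<lambda>s x u. s ^ r * (c u * A x))"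
| add: "separated f \<Longrightarrow> separated g \<Longrightarrow> separated (\<lambda>s x u. f s x u + g s x u)"

lemma separated_mult:
  assumes "separated f" and "separated g"
  shows "separated (\<lambda>s x u. f s x u * g s x u)"
  using assms(1)
proof induction
  case (monomial A c r)
  show ?case using assms(2)
  proof induction
    case (monomial A' c' r')
    have "separated (\<lambda>s x u. s ^ (r + r') * ((c u * c' u) * (A x * A' x)))"
      using \<open>continuous_on UNIV A\<close> \<open>continuous_on UNIV c\<close> monomial
      by (intro separated.monomial continuous_intros)
    then show ?case by (simp add: power_add mult_ac)
  next
    case (add f g)
    then show ?case by (simp add: distrib_left separated.add)
  qed
next
  case (add f g)
  then show ?case by (simp add: distrib_right separated.add)
qed

lemma separated_real_polynomial_segment:
  fixes q :: "'a::real_normed_vector \<Rightarrow> real"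
  assumes "real_polynomial_function q"
  shows "separated (\<lambda>s x u. q (u + s *\<^sub>R (x - u)))"
  using assms
proof induction
  case (linear f)
  then have c: "continuous_on UNIV f" by (simp add: linear_continuous_on)
  \<comment> \<open>\<open>f u - s f u + s f x\<close>, written in the literal shape of the rule
    \<open>monomial\<close>.\<close>
  have "separated (\<lambda>s x u. s ^ 0 * (f u * 1) + (s ^ 1 * (- f u * 1) + s ^ 1 * (1 * f x)))"
    by (intro separated.intros continuous_intros c)
  moreover have "f (u + s *\<^sub>R (x - u)) = s ^ 0 * (f u * 1) + (s ^ 1 * (- f u * 1) + s ^ 1 * (1 * f x))" for s x u
    using linear by (simp add: bounded_linear.linear linear_add linear_scale linear_diff algebra_simps)
  ultimately show ?case by (simp only:)
next
  case (const c)
  have "separated (\<lambda>s x u. s ^ 0 * (c * 1))"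
    by (intro separated.monomial continuous_intros)
  then show ?case by simp
qed (auto intro: separated.add separated_mult)

lemma separated_has_integral:
  fixes f :: "real \<Rightarrow> 'a::topological_space \<Rightarrow> 'b::topological_space \<Rightarrow> real"
  assumes "separated f"
  shows "\<exists>K c A. (\<forall>k. continuous_on UNIV (c k)) \<and> (\<forall>k. continuous_on UNIV (A k)) \<and>
    (\<forall>x u. ((\<lambda>s. (1 - s) * f s x u) has_integral (\<Sum>k<(K::nat). c k u * A k x)) {0..1})"
  using assms
proof induction
  case (monomial A c r)
  have "continuous_on {0..1} (\<lambda>s::real. (1 - s) * s ^ r)" by (intro continuous_intros)
  \<comment> \<open>The moment \<open>m\<close> of \<open>(1 - s) s ^ r\<close> is a constant and is
    absorbed into the coefficient.\<close>
  then obtain m where m: "((\<lambda>s::real. (1 - s) * s ^ r) has_integral m) {0..1}"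
    using integrable_continuous_real by blast
  have "((\<lambda>s. (1 - s) * (s ^ r * (c u * A x))) has_integral (\<Sum>k<1::nat. (m * c u) * A x)) {0..1}" for x u
    using has_integral_mult_left[OF m, of "c u * A x"] by (simp add: mult_ac)
  then show ?case using monomial
    by (intro exI[of _ 1] exI[of _ "\<lambda>_ u. m * c u"] exI[of _ "\<lambda>_. A"])
      (auto intro!: continuous_intros)
next
  case (add f g)
  obtain K1 c1 A1 where 1: "\<And>k. continuous_on UNIV (c1 k)" "\<And>k. continuous_on UNIV (A1 k)"
    "\<And>x u. ((\<lambda>s. (1 - s) * f s x u) has_integral (\<Sum>k<(K1::nat). c1 k u * A1 k x)) {0..1}"
    using add.IH(1) by blast
  obtain K2 c2 A2 where 2: "\<And>k. continuous_on UNIV (c2 k)" "\<And>k. continuous_on UNIV (A2 k)"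
    "\<And>x u. ((\<lambda>s. (1 - s) * g s x u) has_integral (\<Sum>k<(K2::nat). c2 k u * A2 k x)) {0..1}"
    using add.IH(2) by blast
  \<comment> \<open>The two lists of terms are concatenated: indices from \<open>K1\<close> on
    belong to \<open>g\<close>.\<close>
  define c where "c = (\<lambda>k. if k < K1 then c1 k else c2 (k - K1))"
  define A where "A = (\<lambda>k. if k < K1 then A1 k else A2 (k - K1))"
  have "(\<Sum>k<K1 + K2. c k u * A k x) = (\<Sum>k<K1. c1 k u * A1 k x) + (\<Sum>k<K2. c2 k u * A2 k x)" for x u
  proof -
    have "(\<Sum>k<K1 + K2. c k u * A k x) = (\<Sum>k<K1. c k u * A k x) + (\<Sum>k=K1..<K1 + K2. c k u * A k x)"
      by (simp add: lessThan_atLeast0 sum.atLeastLessThan_concat)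
    also have "(\<Sum>k=K1..<K1 + K2. c k u * A k x) = (\<Sum>k<K2. c (k + K1) u * A (k + K1) x)"
      using sum.shift_bounds_nat_ivl[of "\<lambda>k. c k u * A k x" 0 K1 K2]
      by (simp add: lessThan_atLeast0 add.commute)
    finally show ?thesis by (simp add: c_def A_def)
  qed
  then have "((\<lambda>s. (1 - s) * (f s x u + g s x u)) has_integral (\<Sum>k<K1 + K2. c k u * A k x)) {0..1}" for x u
    using has_integral_add[OF 1(3) 2(3)] by (simp add: distrib_left)
  moreover have "continuous_on UNIV (c k)" "continuous_on UNIV (A k)" for k
    using 1 2 by (simp_all add: c_def A_def)
  ultimately show ?case by blast
qed

text \<open>An index \<open>(a, b, k)\<close> names the \<open>k\<close>-th separated term of the
  Hessian entry \<open>(a, b)\<close>. The vector \<open>v\<close> is kept apart from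
  \<open>x - u\<close>, so that the remainder becomes a quadratic form in \<open>v\<close> whose
  definiteness can be discussed; \<open>u\<close> enters only through the coefficients
  \<open>c\<close>.\<close>

lemma hessian_remainder_separated:
  fixes f :: "real ^ 'n::finite \<Rightarrow> real"
  assumes f: "real_polynomial_function f"
  obtains \<Theta> :: "('n \<times> 'n \<times> nat) set" and c A where "finite \<Theta>"
    "\<And>\<theta>. continuous_on UNIV (c \<theta>)" "\<And>\<theta>. continuous_on UNIV (A \<theta>)"
    "\<And>x u v. ((\<lambda>s. (1 - s) * inner v (hessian f (u + s *\<^sub>R (x - u)) *v v)) has_integral
      (\<Sum>\<theta>\<in>\<Theta>. c \<theta> u * (A \<theta> x * (vec_nth v (fst \<theta>) * vec_nth v (fst (snd \<theta>)))))) {0..1}"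
proof -
  let ?d = "\<lambda>a b. partial_deriv a (partial_deriv b f)"
  \<comment> \<open>The number of terms and both families are packed into one triple
    \<open>T\<close>, so that they can be chosen for all entries at once.\<close>
  define sep where "sep = (\<lambda>a b T. (\<forall>k. continuous_on UNIV (fst (snd T) k)) \<and> (\<forall>k. continuous_on UNIV (snd (snd T) k)) \<and>
    (\<forall>x u. ((\<lambda>s. (1 - s) * ?d a b (u + s *\<^sub>R (x - u))) has_integral
      (\<Sum>k<(fst T :: nat). fst (snd T) k u * snd (snd T) k x)) {0..1}))"
  have "\<exists>T. sep a b T" for a b
    using separated_has_integral[OF separated_real_polynomial_segment[of "?d a b"]] f
    by (simp add: sep_def real_polynomial_function_partial_deriv)
  then obtain T where sep: "\<And>a b. sep a b (T a b)"
    by metis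
  have T: "\<And>a b k. continuous_on UNIV (fst (snd (T a b)) k)"
      "\<And>a b k. continuous_on UNIV (snd (snd (T a b)) k)"
    and int: "\<And>a b x u. ((\<lambda>s. (1 - s) * ?d a b (u + s *\<^sub>R (x - u))) has_integral
      (\<Sum>k<fst (T a b). fst (snd (T a b)) k u * snd (snd (T a b)) k x)) {0..1}"
    using sep by (auto simp: sep_def)
  define \<Theta> where "\<Theta> = (SIGMA a:UNIV. SIGMA b:UNIV. {..<fst (T a b)})"
  define c where "c = (\<lambda>(a, b, k). fst (snd (T a b)) k)"
  define A where "A = (\<lambda>(a, b, k). snd (snd (T a b)) k)"
  show thesis
  proof (rule that[of \<Theta> c A])
    show "finite \<Theta>" by (simp add: \<Theta>_def)
    show "continuous_on UNIV (c \<theta>)" "continuous_on UNIV (A \<theta>)" for \<theta>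
      using T by (auto simp: c_def A_def split: prod.split)
    fix x u v :: "real ^ 'n"
    have "((\<lambda>s. \<Sum>a\<in>UNIV. \<Sum>b\<in>UNIV. vec_nth v a * vec_nth v b * ((1 - s) * ?d a b (u + s *\<^sub>R (x - u)))) has_integral
        (\<Sum>a\<in>UNIV. \<Sum>b\<in>UNIV. vec_nth v a * vec_nth v b *
          (\<Sum>k<fst (T a b). fst (snd (T a b)) k u * snd (snd (T a b)) k x))) {0..1}"
      by (intro has_integral_sum has_integral_mult_right int finite)
    moreover have "(\<Sum>a\<in>UNIV. \<Sum>b\<in>UNIV. vec_nth v a * vec_nth v b *
          (\<Sum>k<fst (T a b). fst (snd (T a b)) k u * snd (snd (T a b)) k x)) =
        (\<Sum>\<theta>\<in>\<Theta>. c \<theta> u * (A \<theta> x * (vec_nth v (fst \<theta>) * vec_nth v (fst (snd \<theta>)))))"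
      by (simp add: \<Theta>_def sum.Sigma split_beta c_def A_def sum_distrib_left mult_ac)
    moreover have "(1 - s) * inner v (hessian f y *v v) =
        (\<Sum>a\<in>UNIV. \<Sum>b\<in>UNIV. vec_nth v a * vec_nth v b * ((1 - s) * ?d a b y))" for s y
      by (simp add: inner_hessian_eq_sum sum_distrib_left mult_ac)
    ultimately show "((\<lambda>s. (1 - s) * inner v (hessian f (u + s *\<^sub>R (x - u)) *v v)) has_integral
      (\<Sum>\<theta>\<in>\<Theta>. c \<theta> u * (A \<theta> x * (vec_nth v (fst \<theta>) * vec_nth v (fst (snd \<theta>)))))) {0..1}"
      by simp
  qed
qed

subsection \<open>Linear matrix inequalities\<close>

lemma quadratic_form_symmetrize:
  fixes M :: "'i \<Rightarrow> 'i \<Rightarrow> real"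
  shows "(\<Sum>a\<in>I. \<Sum>b\<in>I. z a * z b * ((M a b + M b a) / 2)) = (\<Sum>a\<in>I. \<Sum>b\<in>I. z a * z b * M a b)"
proof -
  have "(\<Sum>a\<in>I. \<Sum>b\<in>I. z a * z b * M b a) = (\<Sum>a\<in>I. \<Sum>b\<in>I. z a * z b * M a b)"
    by (subst sum.swap) (simp add: mult_ac)
  then show ?thesis
    by (simp add: add_divide_distrib distrib_left sum.distrib flip: sum_divide_distrib)
qed

text \<open>Bridge from quadratic forms over arbitrary finite index sets to the numbered matrices of
  \<open>SDP_representable\<close>: \<open>f\<close> numbers the rows, \<open>h\<close> the lifting
  variables.\<close>

lemma SDP_representableI:
  fixes S :: "(real ^ 'n::finite) set" and I :: "'i set" and P :: "'p set"
  assumes I: "finite I" and P: "finite P"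
    and S: "S = {x. \<exists>y. \<forall>z. 0 \<le> (\<Sum>a\<in>I. \<Sum>b\<in>I. z a * z b *
      (M0 a b + (\<Sum>i\<in>UNIV. vec_nth x i * M i a b) + (\<Sum>p\<in>P. y p * G p a b)))}"
  shows "SDP_representable S"
proof -
  define d where "d = card I"
  obtain f where f: "bij_betw f {0..<d} I"
    using ex_bij_betw_nat_finite[OF I] d_def by blast
  obtain h where h: "bij_betw h {1..card P} P"
    using ex_bij_betw_nat_finite_1[OF P] by blast
  \<comment> \<open>The symmetric part, which has the same quadratic form. Taking it is linear,
    hence compatible with the pencil.\<close>
  define mk where "mk = (\<lambda>M :: 'i \<Rightarrow> 'i \<Rightarrow> real. Matrix.mat d d (\<lambda>(r, c). (M (f r) (f c) + M (f c) (f r)) / 2))"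
  have sym: "sym_mat d (mk M)" for M
    by (auto simp: sym_mat_def mk_def intro!: eq_matI)
  have pencil: "linear_pencil d (card P) (mk M0) (\<lambda>i. mk (M i)) (\<lambda>j. mk (G (h j))) x y =
      mk (\<lambda>a b. M0 a b + (\<Sum>i\<in>UNIV. vec_nth x i * M i a b) + (\<Sum>j=1..card P. y j * G (h j) a b))" for x y
    unfolding linear_pencil_def mk_def
    by (rule eq_matI)
      (auto simp: sum.distrib add_divide_distrib distrib_left simp flip: sum_divide_distrib)
  have psd: "pos_semidef_mat (mk M) \<longleftrightarrow> (\<forall>z. 0 \<le> (\<Sum>a\<in>I. \<Sum>b\<in>I. z a * z b * M a b))" for M
  proof -
    have quad: "scalar_prod v (mult_mat_vec (mk M) v) = (\<Sum>a\<in>I. \<Sum>b\<in>I. z a * z b * M a b)"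
      if v: "v \<in> carrier_vec d" and z: "\<And>r. r < d \<Longrightarrow> vec_index v r = z (f r)" for v z
    proof -
      have "scalar_prod v (mult_mat_vec (mk M) v) =
          (\<Sum>r\<in>{0..<d}. \<Sum>c\<in>{0..<d}. z (f r) * z (f c) * ((M (f r) (f c) + M (f c) (f r)) / 2))"
        using v z by (simp add: scalar_prod_def mk_def sum_distrib_left mult_ac)
      also have "\<dots> = (\<Sum>a\<in>I. \<Sum>b\<in>I. z a * z b * ((M a b + M b a) / 2))"
        by (subst (1 2) sum.reindex_bij_betw[OF f, symmetric]) simp
      also have "\<dots> = (\<Sum>a\<in>I. \<Sum>b\<in>I. z a * z b * M a b)"
        by (rule quadratic_form_symmetrize)
      finally show ?thesis .
    qed
    have "(\<forall>v\<in>carrier_vec d. 0 \<le> scalar_prod v (mult_mat_vec (mk M) v)) \<longleftrightarrow>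
        (\<forall>z. 0 \<le> (\<Sum>a\<in>I. \<Sum>b\<in>I. z a * z b * M a b))" (is "?L \<longleftrightarrow> ?R")
    proof
      assume ?L
      show ?R
      proof
        fix z
        have "0 \<le> scalar_prod (Matrix.vec d (\<lambda>r. z (f r))) (mult_mat_vec (mk M) (Matrix.vec d (\<lambda>r. z (f r))))"
          using \<open>?L\<close> by simp
        then show "0 \<le> (\<Sum>a\<in>I. \<Sum>b\<in>I. z a * z b * M a b)"
          using quad[of "Matrix.vec d (\<lambda>r. z (f r))" z] by simp
      qed
    next
      assume ?R
      show ?L
      proof
        fix v :: "real Matrix.vec" assume v: "v \<in> carrier_vec d"
        have "vec_index v r = vec_index v (inv_into {0..<d} f (f r))" if "r < d" for r
          using that f by (simp add: bij_betw_def inv_into_f_f)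
        then show "0 \<le> scalar_prod v (mult_mat_vec (mk M) v)"
          using quad[OF v, of "\<lambda>a. vec_index v (inv_into {0..<d} f a)"] \<open>?R\<close> by simp
      qed
    qed
    moreover have "square_mat (mk M)" "transpose_mat (mk M) = mk M" "dim_row (mk M) = d"
      using sym[of M] by (auto simp: sym_mat_def)
    ultimately show ?thesis by (simp add: pos_semidef_mat_def)
  qed
  have eq: "S = {x. \<exists>y. pos_semidef_mat (linear_pencil d (card P) (mk M0) (\<lambda>i. mk (M i)) (\<lambda>j. mk (G (h j))) x y)}"
    (is "S = ?T")
  proof (intro subset_antisym subsetI)
    fix x assume "x \<in> S"
    then obtain y where y: "\<And>z. 0 \<le> (\<Sum>a\<in>I. \<Sum>b\<in>I. z a * z b *
      (M0 a b + (\<Sum>i\<in>UNIV. vec_nth x i * M i a b) + (\<Sum>p\<in>P. y p * G p a b)))"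
      unfolding S by blast
    have "(\<Sum>p\<in>P. y p * G p a b) = (\<Sum>j=1..card P. (y \<circ> h) j * G (h j) a b)" for a b
      by (subst sum.reindex_bij_betw[OF h, symmetric]) simp
    then show "x \<in> ?T" using y by (auto simp only: pencil psd mem_Collect_eq)
  next
    fix x assume "x \<in> ?T"
    then obtain y where y: "\<And>z. 0 \<le> (\<Sum>a\<in>I. \<Sum>b\<in>I. z a * z b *
      (M0 a b + (\<Sum>i\<in>UNIV. vec_nth x i * M i a b) + (\<Sum>j=1..card P. y j * G (h j) a b)))"
      by (auto simp only: pencil psd mem_Collect_eq)
    have "(\<Sum>p\<in>P. y (inv_into {1..card P} h p) * G p a b) = (\<Sum>j=1..card P. y j * G (h j) a b)" for a b
      using h by (subst sum.reindex_bij_betw[OF h, symmetric])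
        (auto simp: bij_betw_def inv_into_f_f intro!: sum.cong)
    then show "x \<in> S" unfolding S mem_Collect_eq using y
      by (intro exI[of _ "\<lambda>p. y (inv_into {1..card P} h p)"]) simp
  qed
  then show ?thesis
    unfolding SDP_representable_def
    by (intro exI[of _ "card P"] exI[of _ d] exI[of _ "mk M0"] exI[of _ "\<lambda>i. mk (M i)"]
        exI[of _ "\<lambda>j. mk (G (h j))"] conjI allI ballI sym eq)
qed

section \<open>Finitely generated cones of coefficient vectors\<close>

text \<open>Rounding the coordinates in units of \<open>\<epsilon>\<close> sorts \<open>C\<close>
  into finitely many cells, and each inhabited cell contributes one representative. The net thus
  consists of members of \<open>C\<close>, which inherit the uniform lower bound
  \<open>\<delta>\<close> in the next lemma.\<close>

lemma finite_net_of_bounded: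
  fixes C :: "('k \<Rightarrow> real) set"
  assumes "finite \<Theta>" and R: "\<And>c \<theta>. c \<in> C \<Longrightarrow> \<theta> \<in> \<Theta> \<Longrightarrow> \<bar>c \<theta>\<bar> \<le> R" and "\<epsilon> > 0"
  obtains N where "finite N" "N \<subseteq> C" "\<And>c. c \<in> C \<Longrightarrow> \<exists>d\<in>N. \<forall>\<theta>\<in>\<Theta>. \<bar>c \<theta> - d \<theta>\<bar> \<le> \<epsilon>"
proof -
  \<comment> \<open>\<open>restrict\<close> fixes the values outside \<open>\<Theta>\<close>, so
    that the cells lie in a finite product.\<close>
  define cell where "cell = (\<lambda>c. restrict (\<lambda>\<theta>. \<lfloor>c \<theta> / \<epsilon>\<rfloor>) \<Theta>)"
  have "cell c \<in> PiE \<Theta> (\<lambda>_. {\<lfloor>- R / \<epsilon>\<rfloor>..\<lfloor>R / \<epsilon>\<rfloor>})" if c: "c \<in> C" for c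
  proof (rule PiE_I)
    fix \<theta> assume \<theta>: "\<theta> \<in> \<Theta>"
    have "- R \<le> c \<theta>" "c \<theta> \<le> R" using R[OF c \<theta>] by auto
    then have "\<lfloor>- R / \<epsilon>\<rfloor> \<le> \<lfloor>c \<theta> / \<epsilon>\<rfloor>" "\<lfloor>c \<theta> / \<epsilon>\<rfloor> \<le> \<lfloor>R / \<epsilon>\<rfloor>"
      using \<open>\<epsilon> > 0\<close> by (intro floor_mono divide_right_mono; simp)+
    then show "cell c \<theta> \<in> {\<lfloor>- R / \<epsilon>\<rfloor>..\<lfloor>R / \<epsilon>\<rfloor>}" using \<theta> by (simp add: cell_def)
  qed (simp add: cell_def)
  then have "cell ` C \<subseteq> PiE \<Theta> (\<lambda>_. {\<lfloor>- R / \<epsilon>\<rfloor>..\<lfloor>R / \<epsilon>\<rfloor>})" by blast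
  then have fin: "finite (cell ` C)"
    by (rule finite_subset) (simp add: \<open>finite \<Theta>\<close> finite_PiE)
  show thesis
  proof (rule that[of "inv_into C cell ` cell ` C"])
    show "finite (inv_into C cell ` cell ` C)" using fin by simp
    show "inv_into C cell ` cell ` C \<subseteq> C" by (auto intro: inv_into_into)
    fix c assume c: "c \<in> C"
    define d where "d = inv_into C cell (cell c)"
    have eq: "cell d = cell c" unfolding d_def using c by (simp add: f_inv_into_f)
    have "\<bar>c \<theta> - d \<theta>\<bar> \<le> \<epsilon>" if "\<theta> \<in> \<Theta>" for \<theta>
    proof -
      have "\<lfloor>d \<theta> / \<epsilon>\<rfloor> = \<lfloor>c \<theta> / \<epsilon>\<rfloor>"
        using fun_cong[OF eq, of \<theta>] that by (simp add: cell_def)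
      then have "\<bar>c \<theta> / \<epsilon> - d \<theta> / \<epsilon>\<bar> \<le> 1" by linarith
      then have "\<bar>c \<theta> - d \<theta>\<bar> / \<epsilon> \<le> 1"
        using \<open>\<epsilon> > 0\<close> by (simp add: abs_divide flip: diff_divide_distrib)
      then show ?thesis using \<open>\<epsilon> > 0\<close> by simp
    qed
    then show "\<exists>d\<in>inv_into C cell ` cell ` C. \<forall>\<theta>\<in>\<Theta>. \<bar>c \<theta> - d \<theta>\<bar> \<le> \<epsilon>"
      using c d_def by blast
  qed
qed

text \<open>A finite net of \<open>C\<close>, with a multiple of \<open>\<nu>\<close> subtracted that absorbs the distance
  to the net, generates together with the pairs \<open>\<plusminus> A \<theta> + M \<nu>\<close> a cone containing \<open>C\<close>. The conclusion is
  phrased dually: \<open>a\<close> and \<open>b\<close> are the values of a linear functional on \<open>A\<close> and \<open>\<nu>\<close>.\<close>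

lemma finitely_generated_cone_over_bounded:
  fixes C :: "('k \<Rightarrow> real) set" and A :: "'k \<Rightarrow> 'x \<Rightarrow> real" and \<nu> :: "'x \<Rightarrow> real"
  assumes fin: "finite \<Theta>" and R: "\<And>c \<theta>. c \<in> C \<Longrightarrow> \<theta> \<in> \<Theta> \<Longrightarrow> \<bar>c \<theta>\<bar> \<le> R"
    and M: "M \<ge> 0" "\<And>\<theta> \<xi>. \<theta> \<in> \<Theta> \<Longrightarrow> \<xi> \<in> X \<Longrightarrow> \<bar>A \<theta> \<xi>\<bar> \<le> M * \<nu> \<xi>"
    and \<nu>: "\<And>\<xi>. \<xi> \<in> X \<Longrightarrow> 0 \<le> \<nu> \<xi>"
    and \<delta>: "\<delta> > 0" "\<And>c \<xi>. c \<in> C \<Longrightarrow> \<xi> \<in> X \<Longrightarrow> \<delta> * \<nu> \<xi> \<le> (\<Sum>\<theta>\<in>\<Theta>. c \<theta> * A \<theta> \<xi>)"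
  obtains D :: "(('k \<Rightarrow> real) \<times> real) set" where "finite D"
    "\<And>d e \<xi>. (d, e) \<in> D \<Longrightarrow> \<xi> \<in> X \<Longrightarrow> 0 \<le> (\<Sum>\<theta>\<in>\<Theta>. d \<theta> * A \<theta> \<xi>) + e * \<nu> \<xi>"
    "\<And>c a b. c \<in> C \<Longrightarrow> (\<And>d e. (d, e) \<in> D \<Longrightarrow> 0 \<le> (\<Sum>\<theta>\<in>\<Theta>. d \<theta> * a \<theta>) + e * b)
      \<Longrightarrow> 0 \<le> (\<Sum>\<theta>\<in>\<Theta>. c \<theta> * a \<theta>)"
proof -
  \<comment> \<open>Replacing \<open>c\<close> by a net point changes at most
    \<open>card \<Theta>\<close> coefficients by \<open>\<epsilon>\<close> each, at a cost of at
    most \<open>\<epsilon> * M * card \<Theta>\<close> times \<open>\<nu>\<close>. This must not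
    exceed \<open>\<delta>\<close>; the summand 1 keeps the denominator positive.\<close>
  define \<epsilon> where "\<epsilon> = \<delta> / (M * card \<Theta> + 1)"
  have pos: "M * card \<Theta> + 1 > 0" using M(1) by (simp add: add_nonneg_pos)
  then have \<epsilon>: "\<epsilon> > 0" using \<delta>(1) by (simp add: \<epsilon>_def)
  have "\<epsilon> * (M * card \<Theta> + 1) = \<delta>" using pos by (simp add: \<epsilon>_def)
  then have le: "\<epsilon> * M * card \<Theta> \<le> \<delta>" using \<epsilon> by (simp add: algebra_simps)
  obtain N where N: "finite N" "N \<subseteq> C" "\<And>c. c \<in> C \<Longrightarrow> \<exists>d\<in>N. \<forall>\<theta>\<in>\<Theta>. \<bar>c \<theta> - d \<theta>\<bar> \<le> \<epsilon>"
    using finite_net_of_bounded[where C = C and R = R, OF fin _ \<epsilon>] R by metis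
  define unit :: "real \<Rightarrow> 'k \<Rightarrow> 'k \<Rightarrow> real" where "unit = (\<lambda>\<sigma> \<theta>' \<theta>. if \<theta> = \<theta>' then \<sigma> else 0)"
  have unit: "(\<Sum>\<theta>\<in>\<Theta>. unit \<sigma> \<theta>' \<theta> * a \<theta>) = \<sigma> * a \<theta>'" if "\<theta>' \<in> \<Theta>" for \<sigma> \<theta>' a
    using that fin by (simp add: unit_def if_distrib[of "\<lambda>t. t * _"] cong: if_cong)
  define D where "D = (\<lambda>d. (d, - (\<epsilon> * M * card \<Theta>))) ` N \<union>
    (\<lambda>(\<sigma>, \<theta>'). (unit \<sigma> \<theta>', M)) ` ({1, -1} \<times> \<Theta>)"
  show thesis
  proof (rule that[of D])
    show "finite D" using N(1) fin by (simp add: D_def)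
  next
    fix d e \<xi> assume "(d, e) \<in> D" and \<xi>: "\<xi> \<in> X"
    then consider "d \<in> N" "e = - (\<epsilon> * M * card \<Theta>)"
      | \<sigma> \<theta>' where "\<sigma> \<in> {1, -1}" "\<theta>' \<in> \<Theta>" "d = unit \<sigma> \<theta>'" "e = M"
      unfolding D_def by auto
    then show "0 \<le> (\<Sum>\<theta>\<in>\<Theta>. d \<theta> * A \<theta> \<xi>) + e * \<nu> \<xi>"
    proof cases
      case 1
      then have "\<delta> * \<nu> \<xi> \<le> (\<Sum>\<theta>\<in>\<Theta>. d \<theta> * A \<theta> \<xi>)" using N(2) \<xi> by (intro \<delta>(2)) auto
      moreover have "\<epsilon> * M * card \<Theta> * \<nu> \<xi> \<le> \<delta> * \<nu> \<xi>"
        using le \<nu>[OF \<xi>] by (rule mult_right_mono)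
      ultimately show ?thesis using 1 by simp
    next
      case 2
      then show ?thesis using M(2)[OF 2(2) \<xi>] by (auto simp: unit)
    qed
  next
    fix c a b
    assume c: "c \<in> C" and nonneg: "\<And>d e. (d, e) \<in> D \<Longrightarrow> 0 \<le> (\<Sum>\<theta>\<in>\<Theta>. d \<theta> * a \<theta>) + e * b"
    \<comment> \<open>The generators \<open>\<plusminus> A \<theta> + M \<nu>\<close> carry the
      pointwise bound on \<open>A \<theta>\<close> over to the functional.\<close>
    have a: "\<bar>a \<theta>\<bar> \<le> M * b" if "\<theta> \<in> \<Theta>" for \<theta>
    proof -
      have "(unit 1 \<theta>, M) \<in> D" "(unit (-1) \<theta>, M) \<in> D" using that by (auto simp: D_def)
      then show ?thesis using nonneg[of "unit 1 \<theta>" M] nonneg[of "unit (-1) \<theta>" M] that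
        by (simp add: unit abs_le_iff)
    qed
    obtain d where d: "d \<in> N" "\<And>\<theta>. \<theta> \<in> \<Theta> \<Longrightarrow> \<bar>c \<theta> - d \<theta>\<bar> \<le> \<epsilon>"
      using N(3)[OF c] by blast
    have "\<epsilon> * M * card \<Theta> * b \<le> (\<Sum>\<theta>\<in>\<Theta>. d \<theta> * a \<theta>)"
      using nonneg[of d "- (\<epsilon> * M * card \<Theta>)"] d(1) by (simp add: D_def)
    \<comment> \<open>Passing from the net point \<open>d\<close> to \<open>c\<close> costs no more
      than the slack just granted by the generator of \<open>d\<close>.\<close>
    moreover have "(\<Sum>\<theta>\<in>\<Theta>. (d \<theta> - c \<theta>) * a \<theta>) \<le> (\<Sum>\<theta>\<in>\<Theta>. \<epsilon> * (M * b))"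
    proof (rule sum_mono)
      fix \<theta> assume \<theta>: "\<theta> \<in> \<Theta>"
      have "(d \<theta> - c \<theta>) * a \<theta> \<le> \<bar>c \<theta> - d \<theta>\<bar> * \<bar>a \<theta>\<bar>"
        by (metis abs_ge_self abs_minus_commute abs_mult)
      also have "\<dots> \<le> \<epsilon> * (M * b)"
        using d(2)[OF \<theta>] a[OF \<theta>] \<epsilon> by (intro mult_mono) auto
      finally show "(d \<theta> - c \<theta>) * a \<theta> \<le> \<epsilon> * (M * b)" .
    qed
    ultimately show "0 \<le> (\<Sum>\<theta>\<in>\<Theta>. c \<theta> * a \<theta>)"
      by (simp add: algebra_simps sum_subtractf)
  qed
qed

section \<open>Lifting by signed weights on finitely many points\<close>

text \<open>The value vectors of the points of \<open>S\<close> span a finite-dimensional space, so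
  finitely many of them suffice. Each further function raises the dimension by at most one, which
  one additional point \<open>q\<close> makes up for.\<close>

lemma finite_points_spanning_evaluations:
  fixes w :: "'j \<Rightarrow> 'x \<Rightarrow> real"
  assumes "finite J"
  obtains P where "finite P" "P \<subseteq> S"
    "\<And>x. x \<in> S \<Longrightarrow> \<exists>y. \<forall>j\<in>J. w j x = (\<Sum>p\<in>P. y p * w j p)"
proof -
  have "\<exists>P. finite P \<and> P \<subseteq> S \<and> (\<forall>x\<in>S. \<exists>y. \<forall>j\<in>J. w j x = (\<Sum>p\<in>P. y p * w j p))"
    using assms
  proof induction
    case empty
    then show ?case by (intro exI[of _ "{}"]) auto
  next
    case (insert i J)
    then obtain P where P: "finite P" "P \<subseteq> S"
      and ev: "\<And>x. x \<in> S \<Longrightarrow> \<exists>y. \<forall>j\<in>J. w j x = (\<Sum>p\<in>P. y p * w j p)" by blast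
    show ?case
    proof (cases "\<forall>x\<in>S. \<exists>y. \<forall>j\<in>insert i J. w j x = (\<Sum>p\<in>P. y p * w j p)")
      case True
      then show ?thesis using P by blast
    next
      case False
      then obtain q where q: "q \<in> S"
        and nq: "\<And>y. \<not> (\<forall>j\<in>insert i J. w j q = (\<Sum>p\<in>P. y p * w j p))" by blast
      have "q \<notin> P"
      proof
        assume "q \<in> P"
        then have "\<forall>j\<in>insert i J. w j q = (\<Sum>p\<in>P. (if p = q then 1 else 0) * w j p)"
          using P(1) by (simp add: if_distrib[of "\<lambda>t. t * _"] sum.delta' sum.delta cong: if_cong)
        then show False using nq[of "\<lambda>p. if p = q then 1 else 0"] by contradiction
      qed
      obtain yq where yq: "\<And>j. j \<in> J \<Longrightarrow> w j q = (\<Sum>p\<in>P. yq p * w j p)"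
        using ev[OF q] by blast
      \<comment> \<open>Evaluation at \<open>q\<close> minus its combination over \<open>P\<close>
        vanishes on all functions of \<open>J\<close> and takes the value \<open>r\<close> on the
        new one. Adding \<open>t\<close> times this functional corrects the value of
        \<open>w i\<close> without disturbing those in \<open>J\<close>.\<close>
      define r where "r = w i q - (\<Sum>p\<in>P. yq p * w i p)"
      have r: "r \<noteq> 0" using nq[of yq] yq by (auto simp: r_def)
      have "\<exists>y. \<forall>j\<in>insert i J. w j x = (\<Sum>p\<in>insert q P. y p * w j p)" if x: "x \<in> S" for x
      proof -
        obtain y where y: "\<And>j. j \<in> J \<Longrightarrow> w j x = (\<Sum>p\<in>P. y p * w j p)"
          using ev[OF x] by blast
        define t where "t = (w i x - (\<Sum>p\<in>P. y p * w i p)) / r"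
        define z where "z = (\<lambda>p. if p = q then t else y p - t * yq p)"
        have z: "(\<Sum>p\<in>insert q P. z p * w j p) =
            t * w j q + (\<Sum>p\<in>P. y p * w j p) - t * (\<Sum>p\<in>P. yq p * w j p)" for j
        proof -
          have "(\<Sum>p\<in>P. z p * w j p) = (\<Sum>p\<in>P. (y p - t * yq p) * w j p)"
            using \<open>q \<notin> P\<close> by (intro sum.cong) (auto simp: z_def)
          also have "\<dots> = (\<Sum>p\<in>P. y p * w j p) - t * (\<Sum>p\<in>P. yq p * w j p)"
            by (simp add: left_diff_distrib sum_subtractf sum_distrib_left mult.assoc)
          finally show ?thesis using P(1) \<open>q \<notin> P\<close> by (simp add: z_def)
        qed
        have "w i x = t * r + (\<Sum>p\<in>P. y p * w i p)" using r by (simp add: t_def)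
        then have "w i x = (\<Sum>p\<in>insert q P. z p * w i p)"
          unfolding z by (simp add: r_def algebra_simps)
        moreover have "w j x = (\<Sum>p\<in>insert q P. z p * w j p)" if "j \<in> J" for j
          unfolding z using yq[OF that] y[OF that] by simp
        ultimately show ?thesis by blast
      qed
      then show ?thesis using P q by (intro exI[of _ "insert q P"]) auto
    qed
  qed
  then show thesis using that by blast
qed

text \<open>Merges matrix conditions, indexed by \<open>j\<close>, and scalar conditions, indexed by
  \<open>r\<close>, into the single inequality that \<open>SDP_representable\<close> allows.\<close>

definition block_diag :: "('j \<Rightarrow> 'i \<Rightarrow> 'i \<Rightarrow> real) \<Rightarrow> ('r \<Rightarrow> real) \<Rightarrow> ('j \<times> 'i) + 'r \<Rightarrow> ('j \<times> 'i) + 'r \<Rightarrow> real" where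
  "block_diag C D \<alpha> \<beta> = (case (\<alpha>, \<beta>) of
     (Inl (j, a), Inl (j', b)) \<Rightarrow> if j = j' then C j a b else 0
   | (Inr r, Inr r') \<Rightarrow> if r = r' then D r else 0
   | _ \<Rightarrow> 0)"

lemma block_diag_quadratic_form:
  fixes z :: "('j \<times> 'i::finite) + 'r::finite \<Rightarrow> real"
  assumes "finite J"
  shows "(\<Sum>\<alpha>\<in>(J \<times> UNIV) <+> UNIV. \<Sum>\<beta>\<in>(J \<times> UNIV) <+> UNIV. z \<alpha> * z \<beta> * block_diag C D \<alpha> \<beta>) =
    (\<Sum>j\<in>J. \<Sum>a\<in>UNIV. \<Sum>b\<in>UNIV. z (Inl (j, a)) * z (Inl (j, b)) * C j a b) + (\<Sum>r\<in>UNIV. (z (Inr r))\<^sup>2 * D r)"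
proof -
  have inner1: "(\<Sum>\<beta>\<in>J \<times> UNIV. z (Inl (j, a)) * z (Inl \<beta>) * block_diag C D (Inl (j, a)) (Inl \<beta>)) =
      (\<Sum>b\<in>UNIV. z (Inl (j, a)) * z (Inl (j, b)) * C j a b)" if "j \<in> J" for j a
  proof -
    have "(\<Sum>\<beta>\<in>J \<times> UNIV. z (Inl (j, a)) * z (Inl \<beta>) * block_diag C D (Inl (j, a)) (Inl \<beta>)) =
      (\<Sum>j'\<in>J. \<Sum>b\<in>UNIV. z (Inl (j, a)) * z (Inl (j', b)) * (if j = j' then C j a b else 0))"
      by (simp add: sum.cartesian_product block_diag_def split_beta cong: if_cong)
    also have "\<dots> = (\<Sum>j'\<in>J. if j = j' then \<Sum>b\<in>UNIV. z (Inl (j, a)) * z (Inl (j', b)) * C j a b else 0)"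
      by (intro sum.cong) auto
    finally show ?thesis using that assms by simp
  qed
  have inner2: "(\<Sum>\<beta>\<in>UNIV. z (Inr r) * z (Inr \<beta>) * block_diag C D (Inr r) (Inr \<beta>)) = (z (Inr r))\<^sup>2 * D r" for r
    by (simp add: block_diag_def if_distrib[of "\<lambda>t. _ * t"] power2_eq_square cong: if_cong)
  have zero: "block_diag C D (Inl \<alpha>) (Inr r) = 0" "block_diag C D (Inr r) (Inl \<alpha>) = 0" for \<alpha> r
    by (auto simp: block_diag_def split: prod.split)
  have "(\<Sum>\<alpha>\<in>J \<times> UNIV. \<Sum>\<beta>\<in>J \<times> UNIV. z (Inl \<alpha>) * z (Inl \<beta>) * block_diag C D (Inl \<alpha>) (Inl \<beta>)) =
      (\<Sum>j\<in>J. \<Sum>a\<in>UNIV. \<Sum>\<beta>\<in>J \<times> UNIV. z (Inl (j, a)) * z (Inl \<beta>) * block_diag C D (Inl (j, a)) (Inl \<beta>))"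
    by (rule sum.cartesian_product')
  also have "\<dots> = (\<Sum>j\<in>J. \<Sum>a\<in>UNIV. \<Sum>b\<in>UNIV. z (Inl (j, a)) * z (Inl (j, b)) * C j a b)"
    using inner1 by (intro sum.cong) auto
  finally show ?thesis using assms
    by (simp add: sum.Plus zero inner2)
qed

lemma block_diag_psd_iff:
  fixes C :: "'j \<Rightarrow> 'i::finite \<Rightarrow> 'i \<Rightarrow> real" and D :: "'r::finite \<Rightarrow> real"
  assumes "finite J"
  shows "(\<forall>z. 0 \<le> (\<Sum>\<alpha>\<in>(J \<times> UNIV) <+> UNIV. \<Sum>\<beta>\<in>(J \<times> UNIV) <+> UNIV. z \<alpha> * z \<beta> * block_diag C D \<alpha> \<beta>))
    \<longleftrightarrow> (\<forall>j\<in>J. \<forall>z. 0 \<le> (\<Sum>a\<in>UNIV. \<Sum>b\<in>UNIV. z a * z b * C j a b)) \<and> (\<forall>r. 0 \<le> D r)"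
  unfolding block_diag_quadratic_form[OF assms]
proof (intro iffI conjI ballI allI)
  assume nn: "\<forall>z. 0 \<le> (\<Sum>j\<in>J. \<Sum>a\<in>UNIV. \<Sum>b\<in>UNIV. z (Inl (j, a)) * z (Inl (j, b)) * C j a b) + (\<Sum>r\<in>UNIV. (z (Inr r))\<^sup>2 * D r)"
  show "0 \<le> (\<Sum>a\<in>UNIV. \<Sum>b\<in>UNIV. z a * z b * C j a b)" if j: "j \<in> J" for j z
  proof -
    define z' :: "('j \<times> 'i) + 'r \<Rightarrow> real" where "z' = case_sum (\<lambda>(j', a). if j' = j then z a else 0) (\<lambda>_. 0)"
    have "(\<Sum>j'\<in>J. \<Sum>a\<in>UNIV. \<Sum>b\<in>UNIV. z' (Inl (j', a)) * z' (Inl (j', b)) * C j' a b) =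
        (\<Sum>j'\<in>J. if j' = j then \<Sum>a\<in>UNIV. \<Sum>b\<in>UNIV. z a * z b * C j' a b else 0)"
      by (intro sum.cong) (auto simp: z'_def)
    then show ?thesis using nn[rule_format, of z'] j assms by (simp add: z'_def)
  qed
  show "0 \<le> D r" for r
    using nn[rule_format, of "case_sum (\<lambda>_. 0) (\<lambda>r'. if r' = r then 1 else 0)"]
    by (simp add: if_distrib[of "\<lambda>t. t\<^sup>2"] if_distrib[of "\<lambda>t. t * _"] cong: if_cong)
next
  fix z :: "('j \<times> 'i) + 'r \<Rightarrow> real"
  assume nn: "(\<forall>j\<in>J. \<forall>z. 0 \<le> (\<Sum>a\<in>UNIV. \<Sum>b\<in>UNIV. z a * z b * C j a b)) \<and> (\<forall>r. 0 \<le> D r)"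
  have "0 \<le> (\<Sum>a\<in>UNIV. \<Sum>b\<in>UNIV. z (Inl (j, a)) * z (Inl (j, b)) * C j a b)" if "j \<in> J" for j
    using nn that by (auto dest: bspec[of _ _ j] spec[of _ "\<lambda>a. z (Inl (j, a))"])
  then show "0 \<le> (\<Sum>j\<in>J. \<Sum>a\<in>UNIV. \<Sum>b\<in>UNIV. z (Inl (j, a)) * z (Inl (j, b)) * C j a b) + (\<Sum>r\<in>UNIV. (z (Inr r))\<^sup>2 * D r)"
    using nn by (simp add: sum_nonneg)
qed

lemma quadratic_form_weighted_sum:
  "(\<Sum>a\<in>A. \<Sum>b\<in>B. z a * z b * (\<Sum>p\<in>P. y p * M p a b)) =
    (\<Sum>p\<in>P. y p * (\<Sum>a\<in>A. \<Sum>b\<in>B. z a * z b * (M p a b :: real)))"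
  by (simp add: sum_distrib_left mult_ac sum.swap[of _ P])

text \<open>The lifting variables are signed weights on finitely many points of \<open>S\<close>, so that the pencil
  describes linear functionals on the span of the relevant functions without choosing a basis.\<close>

lemma SDP_representable_if_certified:
  fixes S :: "(real ^ 'n::finite) set" and B :: "'j \<Rightarrow> real ^ 'n \<Rightarrow> 'i::finite \<Rightarrow> 'i \<Rightarrow> real"
  assumes J: "finite J"
    and psd: "\<And>j x z. j \<in> J \<Longrightarrow> x \<in> S \<Longrightarrow> 0 \<le> (\<Sum>a\<in>UNIV. \<Sum>b\<in>UNIV. z a * z b * B j x a b)"
    and cert: "\<And>P y. finite P \<Longrightarrow> P \<subseteq> S \<Longrightarrow> sum y P = 1 \<Longrightarrow>
      (\<And>j z. j \<in> J \<Longrightarrow> 0 \<le> (\<Sum>p\<in>P. y p * (\<Sum>a\<in>UNIV. \<Sum>b\<in>UNIV. z a * z b * B j p a b))) \<Longrightarrow>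
      (\<Sum>p\<in>P. y p *\<^sub>R p) \<in> S"
  shows "SDP_representable S"
proof -
  \<comment> \<open>The functions whose values weights on \<open>P\<close> must reproduce: all
    matrix entries, the constant 1 and the coordinates.\<close>
  define w :: "('j \<times> 'i \<times> 'i) + 'n option \<Rightarrow> real ^ 'n \<Rightarrow> real" where
    "w = (\<lambda>k p. case k of Inl (j, a, b) \<Rightarrow> B j p a b | Inr None \<Rightarrow> 1 | Inr (Some i) \<Rightarrow> vec_nth p i)"
  have "finite ((J \<times> (UNIV :: ('i \<times> 'i) set)) <+> (UNIV :: 'n option set))" using J by simp
  then obtain P where P: "finite P" "P \<subseteq> S"
    and ev: "\<And>x. x \<in> S \<Longrightarrow> \<exists>y. \<forall>k\<in>(J \<times> UNIV) <+> UNIV. w k x = (\<Sum>p\<in>P. y p * w k p)"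
    by (rule finite_points_spanning_evaluations[where S = S and w = w]) blast
  \<comment> \<open>Each equation becomes two inequalities of opposite sign. The index
    \<open>None\<close> carries \<open>sum y P = 1\<close> and \<open>Some i\<close> the
    \<open>i\<close>-th coordinate of \<open>x = (\<Sum>p\<in>P. y p *\<^sub>R p)\<close>;
    \<open>D0\<close>, \<open>D1 i\<close> and \<open>D2 p\<close> hold the coefficients of 1, of
    the coordinates of \<open>x\<close> and of \<open>y p\<close>.\<close>
  define sg :: "bool \<Rightarrow> real" where "sg = (\<lambda>s. if s then 1 else - 1)"
  define D0 where "D0 = (\<lambda>(s, k :: 'n option). case k of None \<Rightarrow> - sg s | Some _ \<Rightarrow> 0)"
  define D1 where "D1 = (\<lambda>i (s, k :: 'n option). case k of None \<Rightarrow> 0 | Some i' \<Rightarrow> if i = i' then sg s else 0)"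
  define D2 where "D2 = (\<lambda>p :: real ^ 'n. \<lambda>(s, k). case k of None \<Rightarrow> sg s | Some i \<Rightarrow> - (sg s * vec_nth p i))"
  have entries: "block_diag (\<lambda>_ _ _. 0) D0 \<alpha> \<beta> + (\<Sum>i\<in>UNIV. vec_nth x i * block_diag (\<lambda>_ _ _. 0) (D1 i) \<alpha> \<beta>)
      + (\<Sum>p\<in>P. y p * block_diag (\<lambda>j. B j p) (D2 p) \<alpha> \<beta>) =
      block_diag (\<lambda>j a b. \<Sum>p\<in>P. y p * B j p a b)
        (\<lambda>(s, k). case k of None \<Rightarrow> sg s * (sum y P - 1) | Some i \<Rightarrow> sg s * (vec_nth x i - (\<Sum>p\<in>P. y p * vec_nth p i))) \<alpha> \<beta>"
    for x y \<alpha> \<beta>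
    by (auto simp: block_diag_def D0_def D1_def D2_def sum_distrib_left if_distrib[of "\<lambda>t. _ * t"] algebra_simps sum_negf
        split: sum.split prod.split option.split cong: if_cong)
  have feasible: "(\<forall>z. 0 \<le> (\<Sum>\<alpha>\<in>(J \<times> UNIV) <+> UNIV. \<Sum>\<beta>\<in>(J \<times> UNIV) <+> UNIV. z \<alpha> * z \<beta> *
      (block_diag (\<lambda>_ _ _. 0) D0 \<alpha> \<beta> + (\<Sum>i\<in>UNIV. vec_nth x i * block_diag (\<lambda>_ _ _. 0) (D1 i) \<alpha> \<beta>)
      + (\<Sum>p\<in>P. y p * block_diag (\<lambda>j. B j p) (D2 p) \<alpha> \<beta>)))) \<longleftrightarrow>
      (\<forall>j\<in>J. \<forall>z. 0 \<le> (\<Sum>p\<in>P. y p * (\<Sum>a\<in>UNIV. \<Sum>b\<in>UNIV. z a * z b * B j p a b))) \<and>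
      sum y P = 1 \<and> x = (\<Sum>p\<in>P. y p *\<^sub>R p)" for x y
  proof -
    have "(\<forall>s k. 0 \<le> (case k of None \<Rightarrow> sg s * (sum y P - 1) | Some i \<Rightarrow> sg s * (vec_nth x i - (\<Sum>p\<in>P. y p * vec_nth p i))))
        \<longleftrightarrow> sum y P = 1 \<and> (\<forall>i. vec_nth x i = (\<Sum>p\<in>P. y p * vec_nth p i))"
      by (auto simp: sg_def all_bool_eq split_option_all intro!: order_antisym)
    then show ?thesis
      unfolding entries block_diag_psd_iff[OF J] quadratic_form_weighted_sum
      by (simp add: Finite_Cartesian_Product.vec_eq_iff split_paired_All)
  qed
  have "S = {x. \<exists>y. \<forall>z. 0 \<le> (\<Sum>\<alpha>\<in>(J \<times> UNIV) <+> UNIV. \<Sum>\<beta>\<in>(J \<times> UNIV) <+> UNIV. z \<alpha> * z \<beta> *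
      (block_diag (\<lambda>_ _ _. 0) D0 \<alpha> \<beta> + (\<Sum>i\<in>UNIV. vec_nth x i * block_diag (\<lambda>_ _ _. 0) (D1 i) \<alpha> \<beta>)
      + (\<Sum>p\<in>P. y p * block_diag (\<lambda>j. B j p) (D2 p) \<alpha> \<beta>)))}"
    unfolding feasible
  proof (intro subset_antisym subsetI CollectI)
    \<comment> \<open>Weights that represent evaluation at \<open>x\<close> are feasible, because
      they turn each matrix condition into its instance at \<open>x\<close>.\<close>
    fix x assume x: "x \<in> S"
    then obtain y where y: "\<And>k. k \<in> (J \<times> UNIV) <+> UNIV \<Longrightarrow> w k x = (\<Sum>p\<in>P. y p * w k p)"
      using ev by blast
    have "B j x a b = (\<Sum>p\<in>P. y p * B j p a b)" if "j \<in> J" for j a b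
      using y[OF InlI[of "(j, a, b)"]] that by (simp add: w_def)
    then have "(\<Sum>p\<in>P. y p * (\<Sum>a\<in>UNIV. \<Sum>b\<in>UNIV. z a * z b * B j p a b)) =
        (\<Sum>a\<in>UNIV. \<Sum>b\<in>UNIV. z a * z b * B j x a b)" if "j \<in> J" for j z
      using that by (simp flip: quadratic_form_weighted_sum)
    moreover have "sum y P = 1" using y[OF InrI[OF UNIV_I], of None] by (simp add: w_def)
    moreover have "x = (\<Sum>p\<in>P. y p *\<^sub>R p)"
      using y[OF InrI[OF UNIV_I], of "Some _"] by (simp add: w_def Finite_Cartesian_Product.vec_eq_iff)
    ultimately show "\<exists>y. (\<forall>j\<in>J. \<forall>z. 0 \<le> (\<Sum>p\<in>P. y p * (\<Sum>a\<in>UNIV. \<Sum>b\<in>UNIV. z a * z b * B j p a b))) \<and>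
      sum y P = 1 \<and> x = (\<Sum>p\<in>P. y p *\<^sub>R p)"
      using psd[OF _ x] by (intro exI[of _ y]) simp
  qed (use cert[OF P] in blast)
  then show ?thesis
    by (rule SDP_representableI[rotated 2]) (use J P in simp_all)
qed

subsection \<open>Uniform positivity and the certificate\<close>

text \<open>Tychonoff's theorem; multipliers are functions on the whole type \<open>'i\<close> with
  the product topology.\<close>

lemma compact_box_functions:
  fixes K :: "'i \<Rightarrow> real set"
  assumes "\<And>i. compact (K i)"
  shows "compact {\<mu>. \<forall>i. \<mu> i \<in> K i}"
proof -
  have "compactin (product_topology (\<lambda>i. euclidean) UNIV) (PiE UNIV K)"
    using assms by (simp add: compactin_PiE)
  then show ?thesis
    by (simp add: euclidean_product_topology PiE_def Pi_def)
qed

lemma finite_family_bounded_on_compact: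
  fixes f :: "'i \<Rightarrow> 'a::topological_space \<Rightarrow> real"
  assumes "finite I" and "compact X" and "\<And>i. i \<in> I \<Longrightarrow> continuous_on X (f i)"
  obtains M where "0 \<le> M" "\<And>i x. i \<in> I \<Longrightarrow> x \<in> X \<Longrightarrow> \<bar>f i x\<bar> \<le> M"
proof -
  have "bounded (\<Union>i\<in>I. f i ` X)"
    using assms by (intro bounded_UN ballI compact_imp_bounded compact_continuous_image) auto
  then obtain M where "\<And>y. y \<in> (\<Union>i\<in>I. f i ` X) \<Longrightarrow> \<bar>y\<bar> \<le> M"
    by (auto simp: bounded_iff)
  then show thesis by (intro that[of "max M 0"]) (auto simp: le_max_iff_disj)
qed

section \<open>Convex programs with a Slater point\<close>

text \<open>\<open>pd\<close> is PDLH as a statement about quadratic forms, with the KKT conditions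
  in place of minimality of \<open>u\<close>. The set \<open>I\<close> is meant to index those
  constraints that are positive at \<open>x0\<close>.\<close>

locale pd_convex_program =
  fixes I :: "'i set" and g :: "'i \<Rightarrow> real ^ 'n::finite \<Rightarrow> real" and S :: "(real ^ 'n) set" and x0
  assumes finite_I: "finite I"
    and poly: "\<And>i. i \<in> I \<Longrightarrow> real_polynomial_function (g i)"
    and S_eq: "S = {x. \<forall>i\<in>I. 0 \<le> g i x}"
    and compact_S: "compact S" and convex_S: "convex S" and interior_S: "interior S \<noteq> {}"
    and conc: "\<And>i. i \<in> I \<Longrightarrow> concave_on S (g i)"
    and slater: "x0 \<in> S" "\<And>i. i \<in> I \<Longrightarrow> 0 < g i x0"
    and pd: "\<And>u \<mu> v. u \<in> S \<Longrightarrow> (\<forall>i\<in>I. 0 \<le> \<mu> i) \<Longrightarrow> (\<forall>i\<in>I. \<mu> i * g i u = 0) \<Longrightarrow>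
      (\<Sum>i\<in>I. \<mu> i *\<^sub>R gradient (g i) u) \<noteq> 0 \<Longrightarrow> v \<noteq> 0 \<Longrightarrow>
      (\<Sum>i\<in>I. \<mu> i * inner v (hessian (g i) u *v v)) < 0"
begin

text \<open>The unit norm of the objective and the zero values outside \<open>I\<close> serve to
  make the set of these pairs compact.\<close>

definition KKT :: "(real ^ 'n) \<Rightarrow> ('i \<Rightarrow> real) \<Rightarrow> bool" where
  "KKT u \<mu> \<longleftrightarrow> u \<in> S \<and> (\<forall>i. i \<notin> I \<longrightarrow> \<mu> i = 0) \<and> (\<forall>i\<in>I. 0 \<le> \<mu> i) \<and> (\<forall>i\<in>I. \<mu> i * g i u = 0) \<and>
    norm (\<Sum>i\<in>I. \<mu> i *\<^sub>R gradient (g i) u) = 1"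

lemma KKT_lagrangian_le:
  assumes "KKT u \<mu>" and "x \<in> S"
  shows "(\<Sum>i\<in>I. \<mu> i * g i x) \<le> inner (\<Sum>i\<in>I. \<mu> i *\<^sub>R gradient (g i) u) (x - u)"
proof -
  have "\<mu> i * g i x \<le> \<mu> i * inner (gradient (g i) u) (x - u)" if i: "i \<in> I" for i
  proof -
    have "\<mu> i * g i x \<le> \<mu> i * (g i u + inner (gradient (g i) u) (x - u))"
      using assms i unfolding KKT_def
      by (intro mult_left_mono concave_on_le_tangent[OF poly[OF i] conc[OF i]]) auto
    moreover have "\<mu> i * g i u = 0" using assms(1) i unfolding KKT_def by blast
    ultimately show ?thesis by (simp only: distrib_left)
  qed
  then show ?thesis
    by (simp add: inner_sum_left sum_mono)
qed

text \<open>At the Slater point \<open>\<mu> i * g i x0\<close> is at most the whole Lagrangian sum,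
  hence at most the unit objective applied to \<open>x0 - u\<close>, hence at most the diameter of
  \<open>S\<close>. The multipliers therefore lie in a compact box, from which closed conditions cut
  out the set.\<close>

lemma compact_KKT: "compact {(u, \<mu>). KKT u \<mu>}"
proof -
  define K where "K = (\<lambda>i. if i \<in> I then {0..diameter S / g i x0} else {0::real})"
  define X where "X = S \<times> {\<mu>. \<forall>i. \<mu> i \<in> K i}"
  have X: "compact X" unfolding X_def
    by (intro compact_Times compact_S compact_box_functions) (simp add: K_def)
  have bound: "\<mu> i \<le> diameter S / g i x0" if k: "KKT u \<mu>" and i: "i \<in> I" for u \<mu> i
  proof -
    have nn: "0 \<le> \<mu> j * g j x0" if "j \<in> I" for j
      using k slater(2)[OF that] that by (simp add: KKT_def)
    have "\<mu> i * g i x0 \<le> (\<Sum>j\<in>I. \<mu> j * g j x0)"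
      using nn by (intro member_le_sum[OF i]) (auto simp: finite_I)
    also have "\<dots> \<le> inner (\<Sum>j\<in>I. \<mu> j *\<^sub>R gradient (g j) u) (x0 - u)"
      by (rule KKT_lagrangian_le[OF k slater(1)])
    also have "\<dots> \<le> norm (\<Sum>j\<in>I. \<mu> j *\<^sub>R gradient (g j) u) * norm (x0 - u)"
      by (rule norm_cauchy_schwarz)
    also have "\<dots> \<le> diameter S"
      using k diameter_bounded_bound[OF compact_imp_bounded[OF compact_S] slater(1), of u]
      by (simp add: KKT_def dist_norm)
    finally show ?thesis using slater(2)[OF i] by (simp add: field_simps)
  qed
  have "{(u, \<mu>). KKT u \<mu>} = X \<inter> ((\<Inter>i\<in>I. {p. snd p i * g i (fst p) = 0}) \<inter>
      {p. norm (\<Sum>i\<in>I. snd p i *\<^sub>R gradient (g i) (fst p)) = 1})" (is "?L = X \<inter> ?C")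
  proof (intro subset_antisym subsetI)
    fix p assume "p \<in> ?L"
    then show "p \<in> X \<inter> ?C"
      using bound[of "fst p" "snd p"] by (auto simp: X_def K_def KKT_def)
  next
    fix p assume p: "p \<in> X \<inter> ?C"
    obtain u \<mu> where eq: "p = (u, \<mu>)" by (cases p)
    have X: "u \<in> S" "\<mu> i \<in> K i" for i
      using p by (auto simp: eq X_def)
    have "\<mu> i = 0" if "i \<notin> I" for i using X(2)[of i] that by (simp add: K_def)
    moreover have "0 \<le> \<mu> i" if "i \<in> I" for i using X(2)[of i] that by (simp add: K_def)
    moreover have "\<mu> i * g i u = 0" if "i \<in> I" for i
    proof -
      have "p \<in> {p. snd p i * g i (fst p) = 0}" using p that by blast
      then show ?thesis by (simp only: eq mem_Collect_eq fst_conv snd_conv)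
    qed
    moreover have "norm (\<Sum>i\<in>I. \<mu> i *\<^sub>R gradient (g i) u) = 1"
    proof -
      have "p \<in> {p. norm (\<Sum>i\<in>I. snd p i *\<^sub>R gradient (g i) (fst p)) = 1}" using p by blast
      then show ?thesis by (simp only: eq mem_Collect_eq fst_conv snd_conv)
    qed
    ultimately have "KKT u \<mu>"
      using X(1) unfolding KKT_def by blast
    then show "p \<in> ?L" by (simp add: eq)
  qed
  moreover have "closed ?C"
  proof (intro closed_Int closed_INT ballI closed_Collect_eq)
    have snd: "continuous_on UNIV (\<lambda>p :: (real ^ 'n) \<times> ('i \<Rightarrow> real). snd p i)" for i
      by (rule continuous_on_product_then_coordinatewise[OF continuous_on_snd[OF continuous_on_id]])
    have poly_fst: "continuous_on UNIV (\<lambda>p :: (real ^ 'n) \<times> ('i \<Rightarrow> real). q (fst p))"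
      if "real_polynomial_function q" for q
      by (intro continuous_on_compose2[OF continuous_on_real_polynomial_function[OF that]] continuous_intros) auto
    show "continuous_on UNIV (\<lambda>p. snd p i * g i (fst p))" if "i \<in> I" for i
      by (intro continuous_intros snd poly_fst poly that)
    show "continuous_on UNIV (\<lambda>p. norm (\<Sum>i\<in>I. snd p i *\<^sub>R gradient (g i) (fst p)))"
      unfolding gradient_def
      by (intro continuous_intros continuous_on_vec_lambda snd poly_fst real_polynomial_function_partial_deriv poly)
  qed (auto intro: continuous_intros)
  ultimately show ?thesis using X by (simp add: compact_Int_closed)
qed

text \<open>The integrand is continuous, nonnegative on the segment by concavity and positive at
  \<open>s = 0\<close> by \<open>pd\<close>, so its integral cannot vanish. Like the next lemma,
  this one takes the value \<open>q\<close> as a parameter in order to apply to the separated form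
  of the integral.\<close>

lemma remainder_pos:
  assumes k: "KKT u \<mu>" and x: "x \<in> S" and v: "v \<noteq> 0"
    and int: "((\<lambda>s. (1 - s) * - (\<Sum>i\<in>I. \<mu> i * inner v (hessian (g i) (u + s *\<^sub>R (x - u)) *v v))) has_integral q) {0..1}"
  shows "0 < q"
proof -
  let ?f = "\<lambda>s. (1 - s) * - (\<Sum>i\<in>I. \<mu> i * inner v (hessian (g i) (u + s *\<^sub>R (x - u)) *v v))"
  have u: "u \<in> S" and \<mu>: "\<forall>i\<in>I. 0 \<le> \<mu> i" and compl: "\<forall>i\<in>I. \<mu> i * g i u = 0"
    and n: "norm (\<Sum>i\<in>I. \<mu> i *\<^sub>R gradient (g i) u) = 1"
    using k unfolding KKT_def by blast+
  have nonneg: "0 \<le> ?f s" if s: "s \<in> {0..1}" for s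
  proof -
    have "(1 - s) *\<^sub>R u + s *\<^sub>R x \<in> S"
      using convex_S u x s by (intro convexD) auto
    then have "u + s *\<^sub>R (x - u) \<in> S" by (simp add: algebra_simps)
    then have "(\<Sum>i\<in>I. \<mu> i * inner v (hessian (g i) (u + s *\<^sub>R (x - u)) *v v)) \<le> 0"
      using \<mu> by (intro sum_nonpos mult_nonneg_nonpos
          concave_on_hessian_nonpos[OF poly conc interior_S]) auto
    then show ?thesis using s by (intro mult_nonneg_nonneg) auto
  qed
  have "continuous_on {0..1} ?f"
    by (intro continuous_intros continuous_on_compose2[OF continuous_on_inner_hessian[OF poly, of _ UNIV]]) auto
  then have cont: "continuous_on (cbox 0 1) ?f" by simp
  have "0 < ?f 0"
    using pd[OF u \<mu> compl _ v] n by force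
  have "q \<noteq> 0"
  proof
    assume "q = 0"
    then have "(?f has_integral 0) (cbox 0 1)" using int by simp
    from has_integral_0_cbox_imp_0[OF cont _ this, of 0] nonneg \<open>0 < ?f 0\<close>
    show False by (auto simp: box_real)
  qed
  moreover have "0 \<le> q" using has_integral_nonneg[OF int nonneg] .
  ultimately show ?thesis by simp
qed

lemma remainder_eq:
  assumes k: "KKT u \<mu>"
    and int: "((\<lambda>s. (1 - s) * - (\<Sum>i\<in>I. \<mu> i * inner (x - u) (hessian (g i) (u + s *\<^sub>R (x - u)) *v (x - u)))) has_integral q) {0..1}"
  shows "q = inner (\<Sum>i\<in>I. \<mu> i *\<^sub>R gradient (g i) u) (x - u) - (\<Sum>i\<in>I. \<mu> i * g i x)"
proof -
  have "((\<lambda>s. - (\<Sum>i\<in>I. \<mu> i * ((1 - s) * inner (x - u) (hessian (g i) (u + s *\<^sub>R (x - u)) *v (x - u))))) has_integral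
      - (\<Sum>i\<in>I. \<mu> i * (g i x - g i u - inner (gradient (g i) u) (x - u)))) {0..1}"
    by (intro has_integral_neg has_integral_sum has_integral_mult_right taylor_integral_remainder poly finite_I)
  moreover have "(1 - s) * - (\<Sum>i\<in>I. \<mu> i * r i) = - (\<Sum>i\<in>I. \<mu> i * ((1 - s) * r i))" for s and r :: "'i \<Rightarrow> real"
    by (simp add: sum_distrib_left mult_ac)
  ultimately have "q = - (\<Sum>i\<in>I. \<mu> i * (g i x - g i u - inner (gradient (g i) u) (x - u)))"
    using int by (simp only: has_integral_unique)
  moreover have "(\<Sum>i\<in>I. \<mu> i * g i u) = 0"
    using k unfolding KKT_def by (intro sum.neutral) blast
  ultimately show ?thesis
    by (simp add: right_diff_distrib sum_subtractf inner_sum_left)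
qed

lemma lagrangian_remainder_separated:
  obtains \<Theta> :: "('i \<times> 'n \<times> 'n \<times> nat) set" and c A where "finite \<Theta>"
    "\<And>\<theta>. continuous_on UNIV (c \<theta>)" "\<And>\<theta>. \<theta> \<in> \<Theta> \<Longrightarrow> continuous_on UNIV (A \<theta>)"
    "\<And>u \<mu> x v. ((\<lambda>s. (1 - s) * - (\<Sum>i\<in>I. \<mu> i * inner v (hessian (g i) (u + s *\<^sub>R (x - u)) *v v))) has_integral
      (\<Sum>\<theta>\<in>\<Theta>. c \<theta> (u, \<mu>) * (A \<theta> x * (vec_nth v (fst (snd \<theta>)) * vec_nth v (fst (snd (snd \<theta>))))))) {0..1}"
proof -
  define sep where "sep = (\<lambda>i T. finite (fst T) \<and> (\<forall>\<theta>. continuous_on UNIV (fst (snd T) \<theta>)) \<and>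
    (\<forall>\<theta>. continuous_on UNIV (snd (snd T) \<theta>)) \<and>
    (\<forall>x u v. ((\<lambda>s. (1 - s) * inner v (hessian (g i) (u + s *\<^sub>R (x - u)) *v v)) has_integral
      (\<Sum>\<theta>\<in>(fst T :: ('n \<times> 'n \<times> nat) set). fst (snd T) \<theta> u * (snd (snd T) \<theta> x * (vec_nth v (fst \<theta>) * vec_nth v (fst (snd \<theta>)))))) {0..1}))"
  have "\<exists>T. sep i T" if i: "i \<in> I" for i
  proof -
    obtain \<Theta> :: "('n \<times> 'n \<times> nat) set" and c A where "finite \<Theta>"
      "\<And>\<theta>. continuous_on UNIV (c \<theta>)" "\<And>\<theta>. continuous_on UNIV (A \<theta>)"
      "\<And>x u v. ((\<lambda>s. (1 - s) * inner v (hessian (g i) (u + s *\<^sub>R (x - u)) *v v)) has_integral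
        (\<Sum>\<theta>\<in>\<Theta>. c \<theta> u * (A \<theta> x * (vec_nth v (fst \<theta>) * vec_nth v (fst (snd \<theta>)))))) {0..1}"
      by (rule hessian_remainder_separated[OF poly[OF i]]) (rule that)
    then show ?thesis by (intro exI[of _ "(\<Theta>, c, A)"]) (simp add: sep_def)
  qed
  then obtain T where "\<And>i. i \<in> I \<Longrightarrow> sep i (T i)" by metis
  then have T: "\<And>i. i \<in> I \<Longrightarrow> finite (fst (T i))" "\<And>i \<theta>. i \<in> I \<Longrightarrow> continuous_on UNIV (fst (snd (T i)) \<theta>)"
      "\<And>i \<theta>. i \<in> I \<Longrightarrow> continuous_on UNIV (snd (snd (T i)) \<theta>)"
    and int: "\<And>i x u v. i \<in> I \<Longrightarrow> ((\<lambda>s. (1 - s) * inner v (hessian (g i) (u + s *\<^sub>R (x - u)) *v v)) has_integral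
      (\<Sum>\<theta>\<in>fst (T i). fst (snd (T i)) \<theta> u * (snd (snd (T i)) \<theta> x * (vec_nth v (fst \<theta>) * vec_nth v (fst (snd \<theta>)))))) {0..1}"
    by (simp_all add: sep_def del: split_paired_All)
  define \<Theta> where "\<Theta> = (SIGMA i:I. fst (T i))"
  \<comment> \<open>Outside \<open>I\<close> the choice \<open>T i\<close> is unspecified; the value
    0 makes \<open>c \<theta>\<close> continuous for every \<open>\<theta>\<close>.\<close>
  define c where "c = (\<lambda>(i, \<theta>) (u, \<mu>). if i \<in> I then - (\<mu> i * fst (snd (T i)) \<theta> u) else 0 :: real)"
  define A where "A = (\<lambda>(i, \<theta>). snd (snd (T i)) \<theta>)"
  show thesis
  proof (rule that[of \<Theta> c A])
    show "finite \<Theta>" using T(1) finite_I by (auto simp: \<Theta>_def)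
    have "continuous_on UNIV (\<lambda>p :: (real ^ 'n) \<times> ('i \<Rightarrow> real). - (snd p i * fst (snd (T i)) \<theta> (fst p)))" if "i \<in> I" for i \<theta>
      by (intro continuous_on_minus continuous_on_mult continuous_on_compose2[OF T(2)[OF that] continuous_on_fst[OF continuous_on_id]]
         continuous_on_product_then_coordinatewise[OF continuous_on_snd[OF continuous_on_id]]) auto
    then show "continuous_on UNIV (c \<theta>)" for \<theta>
      by (cases "fst \<theta> \<in> I") (simp_all add: c_def split_beta)
    show "continuous_on UNIV (A \<theta>)" if "\<theta> \<in> \<Theta>" for \<theta>
      using T(3) that by (auto simp: A_def \<Theta>_def)
    fix u \<mu> x and v :: "real ^ 'n"
    have "((\<lambda>s. - (\<Sum>i\<in>I. \<mu> i * ((1 - s) * inner v (hessian (g i) (u + s *\<^sub>R (x - u)) *v v)))) has_integral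
        - (\<Sum>i\<in>I. \<mu> i * (\<Sum>\<theta>\<in>fst (T i). fst (snd (T i)) \<theta> u *
          (snd (snd (T i)) \<theta> x * (vec_nth v (fst \<theta>) * vec_nth v (fst (snd \<theta>))))))) {0..1}"
      by (intro has_integral_neg has_integral_sum has_integral_mult_right int finite_I)
    moreover have "(1 - s) * - (\<Sum>i\<in>I. \<mu> i * r i) = - (\<Sum>i\<in>I. \<mu> i * ((1 - s) * r i))" for s and r :: "'i \<Rightarrow> real"
      by (simp add: sum_distrib_left mult_ac)
    moreover have "- (\<Sum>i\<in>I. \<mu> i * (\<Sum>\<theta>\<in>fst (T i). fst (snd (T i)) \<theta> u *
          (snd (snd (T i)) \<theta> x * (vec_nth v (fst \<theta>) * vec_nth v (fst (snd \<theta>)))))) =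
        (\<Sum>\<theta>\<in>\<Theta>. c \<theta> (u, \<mu>) * (A \<theta> x * (vec_nth v (fst (snd \<theta>)) * vec_nth v (fst (snd (snd \<theta>))))))"
    proof -
      have "- (\<Sum>i\<in>I. \<mu> i * (\<Sum>\<theta>\<in>fst (T i). fst (snd (T i)) \<theta> u *
          (snd (snd (T i)) \<theta> x * (vec_nth v (fst \<theta>) * vec_nth v (fst (snd \<theta>)))))) =
        (\<Sum>i\<in>I. \<Sum>\<theta>\<in>fst (T i). c (i, \<theta>) (u, \<mu>) * (A (i, \<theta>) x * (vec_nth v (fst \<theta>) * vec_nth v (fst (snd \<theta>)))))"
        by (simp add: c_def A_def sum_distrib_left sum_negf mult.assoc)
      then show ?thesis
        using T(1) finite_I by (simp add: \<Theta>_def sum.Sigma split_beta)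
    qed
    ultimately show "((\<lambda>s. (1 - s) * - (\<Sum>i\<in>I. \<mu> i * inner v (hessian (g i) (u + s *\<^sub>R (x - u)) *v v))) has_integral
      (\<Sum>\<theta>\<in>\<Theta>. c \<theta> (u, \<mu>) * (A \<theta> x * (vec_nth v (fst (snd \<theta>)) * vec_nth v (fst (snd (snd \<theta>))))))) {0..1}"
      by (simp only:)
  qed
qed

text \<open>A normalised normal of a hyperplane separating \<open>x\<close> from \<open>S\<close>
  attains its minimum over \<open>S\<close> at some \<open>u\<close>; its multipliers there form the
  pair.\<close>

lemma separating_KKT:
  assumes x: "x \<notin> S"
  obtains u \<mu> where "KKT u \<mu>" "inner (\<Sum>i\<in>I. \<mu> i *\<^sub>R gradient (g i) u) (x - u) < 0"
proof -
  obtain a b where ab: "inner a x < b" "\<And>y. y \<in> S \<Longrightarrow> b < inner a y"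
    using separating_hyperplane_closed_point[OF convex_S compact_imp_closed[OF compact_S] x] by blast
  have "a \<noteq> 0" using ab(1) ab(2)[OF slater(1)] by auto
  define l where "l = a /\<^sub>R norm a"
  have l: "norm l = 1" using \<open>a \<noteq> 0\<close> by (simp add: l_def)
  have "continuous_on S (inner l)" by (intro continuous_intros)
  then obtain u where u: "u \<in> S" "\<And>y. y \<in> S \<Longrightarrow> inner l u \<le> inner l y"
    using continuous_attains_inf[OF compact_S _, of "inner l"] slater(1) by blast
  obtain \<mu> where \<mu>: "\<And>i. i \<in> I \<Longrightarrow> 0 \<le> \<mu> i" "\<And>i. i \<in> I \<Longrightarrow> \<mu> i * g i u = 0"
    "l = (\<Sum>i\<in>I. \<mu> i *\<^sub>R gradient (g i) u)"
    using ex_lagrange_multipliers[OF finite_I poly S_eq conc slater u] by blast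
  define \<nu> where "\<nu> = (\<lambda>i. if i \<in> I then \<mu> i else 0)"
  have eq: "(\<Sum>i\<in>I. \<nu> i *\<^sub>R gradient (g i) u) = l"
    unfolding \<mu>(3) by (intro sum.cong) (auto simp: \<nu>_def)
  show thesis
  proof (rule that[of u \<nu>])
    show "KKT u \<nu>" unfolding KKT_def eq using u(1) \<mu>(1,2) l by (simp add: \<nu>_def)
    have "inner a x < inner a u" using ab(1) ab(2)[OF u(1)] by linarith
    then have "inner a (x - u) < 0" by (simp add: inner_diff_right)
    then show "inner (\<Sum>i\<in>I. \<nu> i *\<^sub>R gradient (g i) u) (x - u) < 0"
      using \<open>a \<noteq> 0\<close> unfolding eq l_def by (simp add: mult_pos_neg)
  qed
qed

lemma SDP_representable_feasible_set: "SDP_representable S"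
proof -
  obtain \<Theta> :: "('i \<times> 'n \<times> 'n \<times> nat) set" and c A where fin: "finite \<Theta>"
    and contc: "\<And>\<theta>. continuous_on UNIV (c \<theta>)" and contA: "\<And>\<theta>. \<theta> \<in> \<Theta> \<Longrightarrow> continuous_on UNIV (A \<theta>)"
    and int: "\<And>u \<mu> x v. ((\<lambda>s. (1 - s) * - (\<Sum>i\<in>I. \<mu> i * inner v (hessian (g i) (u + s *\<^sub>R (x - u)) *v v))) has_integral
      (\<Sum>\<theta>\<in>\<Theta>. c \<theta> (u, \<mu>) * (A \<theta> x * (vec_nth v (fst (snd \<theta>)) * vec_nth v (fst (snd (snd \<theta>))))))) {0..1}"
    by (rule lagrangian_remainder_separated) (rule that)
  define form :: "'i \<times> 'n \<times> 'n \<times> nat \<Rightarrow> real ^ 'n \<Rightarrow> real ^ 'n \<Rightarrow> real" where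
    "form = (\<lambda>\<theta> v v'. vec_nth v (fst (snd \<theta>)) * vec_nth v' (fst (snd (snd \<theta>))))"
  \<comment> \<open>The remainder form of the pair \<open>p = (u, \<mu>)\<close> at
    \<open>x\<close>, with \<open>v\<close> free; at \<open>v = x - u\<close> it is the Taylor
    remainder.\<close>
  define Q where "Q = (\<lambda>p x v. \<Sum>\<theta>\<in>\<Theta>. c \<theta> p * (A \<theta> x * form \<theta> v v))"
  define K where "K = {(u, \<mu>). KKT u \<mu>}"
  have K: "compact K" unfolding K_def by (rule compact_KKT)
  have Q_int: "((\<lambda>s. (1 - s) * - (\<Sum>i\<in>I. \<mu> i * inner v (hessian (g i) (u + s *\<^sub>R (x - u)) *v v))) has_integral Q (u, \<mu>) x v) {0..1}"
    for u \<mu> x v using int by (simp only: Q_def form_def)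
  have Q_pos: "0 < Q p x v" if "p \<in> K" "x \<in> S" "v \<noteq> 0" for p x v
    using remainder_pos[OF _ that(2,3) Q_int, of "fst p" "snd p"] that(1) by (auto simp: K_def)
  have Q_scale: "Q p x (t *\<^sub>R v) = t\<^sup>2 * Q p x v" for p x t v
    by (simp add: Q_def form_def sum_distrib_left power2_eq_square mult_ac)
  obtain \<delta> where \<delta>: "\<delta> > 0" "\<And>p x v. p \<in> K \<Longrightarrow> x \<in> S \<Longrightarrow> \<delta> * inner v v \<le> Q p x v"
  proof (cases "K = {}")
    case True
    then show thesis using that[of 1] by simp
  next
    case False
    \<comment> \<open>\<open>\<delta>\<close> will be the minimum of \<open>Q\<close> over this
      compact set; homogeneity of degree two carries the bound from the unit sphere to all
      \<open>v\<close>.\<close>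
    define Z where "Z = K \<times> S \<times> sphere (0 :: real ^ 'n) 1"
    have "compact Z" unfolding Z_def by (intro compact_Times K compact_S compact_sphere)
    moreover have "Z \<noteq> {}" using False slater(1) by (auto simp: Z_def)
    moreover have "continuous_on Z (\<lambda>z. Q (fst z) (fst (snd z)) (snd (snd z)))"
      unfolding Q_def form_def
      by (intro continuous_intros continuous_on_compose2[OF contc] continuous_on_compose2[OF contA]) auto
    ultimately obtain z where z: "z \<in> Z"
      "\<And>z'. z' \<in> Z \<Longrightarrow> Q (fst z) (fst (snd z)) (snd (snd z)) \<le> Q (fst z') (fst (snd z')) (snd (snd z'))"
      using continuous_attains_inf[of Z "\<lambda>z. Q (fst z) (fst (snd z)) (snd (snd z))"] by blast
    define \<delta> where "\<delta> = Q (fst z) (fst (snd z)) (snd (snd z))"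
    have "0 < \<delta>" unfolding \<delta>_def using z(1) by (intro Q_pos) (auto simp: Z_def)
    moreover have "\<delta> * inner v v \<le> Q p x v" if "p \<in> K" "x \<in> S" for p x v
    proof (cases "v = 0")
      case True
      then show ?thesis using Q_scale[of p x 0 v] by simp
    next
      case False
      define w where "w = v /\<^sub>R norm v"
      have "\<delta> \<le> Q p x w"
        using z(2)[of "(p, x, w)"] that False by (simp add: \<delta>_def Z_def w_def)
      then have "(norm v)\<^sup>2 * \<delta> \<le> (norm v)\<^sup>2 * Q p x w" by (intro mult_left_mono) auto
      also have "\<dots> = Q p x v" unfolding Q_scale[symmetric] using False by (simp add: w_def)
      finally show ?thesis by (simp add: power2_norm_eq_inner mult.commute)
    qed
    ultimately show thesis by (rule that)
  qed
  obtain R where "0 \<le> R" and R: "\<And>\<theta> p. \<theta> \<in> \<Theta> \<Longrightarrow> p \<in> K \<Longrightarrow> \<bar>c \<theta> p\<bar> \<le> R"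
    by (rule finite_family_bounded_on_compact[OF fin K continuous_on_subset[OF contc subset_UNIV]]) (rule that)
  have contA_S: "continuous_on S (A \<theta>)" if "\<theta> \<in> \<Theta>" for \<theta>
    using contA[OF that] by (rule continuous_on_subset) simp
  obtain M where M: "0 \<le> M" "\<And>\<theta> x. \<theta> \<in> \<Theta> \<Longrightarrow> x \<in> S \<Longrightarrow> \<bar>A \<theta> x\<bar> \<le> M"
    by (rule finite_family_bounded_on_compact[where f = A, OF fin compact_S contA_S]) (assumption, rule that)
  have form_le: "\<bar>A \<theta> x * form \<theta> v v\<bar> \<le> M * inner v v" if "\<theta> \<in> \<Theta>" "x \<in> S" for \<theta> x v
  proof -
    have "\<bar>form \<theta> v v\<bar> \<le> norm v * norm v"
      unfolding form_def abs_mult by (intro mult_mono component_le_norm_cart) auto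
    then have "\<bar>A \<theta> x\<bar> * \<bar>form \<theta> v v\<bar> \<le> M * (norm v * norm v)"
      using M that by (intro mult_mono) auto
    then show ?thesis by (simp add: abs_mult dot_square_norm power2_eq_square)
  qed
  \<comment> \<open>The cone lemma with \<open>\<xi> = (x, v)\<close> and the squared norm of
    \<open>v\<close> as \<open>\<nu>\<close>: a pair \<open>(d, e)\<close> encodes a generator, a
    matrix function that is positive semidefinite on \<open>S\<close>.\<close>
  obtain D :: "(('i \<times> 'n \<times> 'n \<times> nat \<Rightarrow> real) \<times> real) set" where D: "finite D"
    and D_psd: "\<And>d e \<xi>. (d, e) \<in> D \<Longrightarrow> \<xi> \<in> S \<times> UNIV \<Longrightarrow>
      0 \<le> (\<Sum>\<theta>\<in>\<Theta>. d \<theta> * (A \<theta> (fst \<xi>) * form \<theta> (snd \<xi>) (snd \<xi>))) + e * inner (snd \<xi>) (snd \<xi>)"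
    and D_cone: "\<And>c' a b. c' \<in> (\<lambda>p \<theta>. c \<theta> p) ` K \<Longrightarrow> (\<And>d e. (d, e) \<in> D \<Longrightarrow> 0 \<le> (\<Sum>\<theta>\<in>\<Theta>. d \<theta> * a \<theta>) + e * b)
      \<Longrightarrow> 0 \<le> (\<Sum>\<theta>\<in>\<Theta>. c' \<theta> * a \<theta>)"
  proof (rule finitely_generated_cone_over_bounded[of \<Theta> "(\<lambda>p \<theta>. c \<theta> p) ` K" R M "S \<times> UNIV"
        "\<lambda>\<theta> \<xi>. A \<theta> (fst \<xi>) * form \<theta> (snd \<xi>) (snd \<xi>)" "\<lambda>\<xi>. inner (snd \<xi>) (snd \<xi>)" \<delta>])
    show "\<delta> * inner (snd \<xi>) (snd \<xi>) \<le> (\<Sum>\<theta>\<in>\<Theta>. c' \<theta> * (A \<theta> (fst \<xi>) * form \<theta> (snd \<xi>) (snd \<xi>)))"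
      if "c' \<in> (\<lambda>p \<theta>. c \<theta> p) ` K" "\<xi> \<in> S \<times> UNIV" for c' \<xi>
      using \<delta>(2)[of _ "fst \<xi>" "snd \<xi>"] that by (auto simp: Q_def)
  qed (use fin R M(1) form_le \<delta>(1) in auto)
  \<comment> \<open>A coefficient vector \<open>z\<close> with \<open>t = z None\<close> and
    \<open>w = z \<circ> Some\<close> yields the argument \<open>t x - w\<close>, so that all base
    points are covered by one matrix inequality per generator.\<close>
  define \<zeta> :: "real ^ 'n \<Rightarrow> 'n option \<Rightarrow> real ^ 'n" where "\<zeta> = (\<lambda>x. case_option x (\<lambda>i. - axis i 1))"
  define bil where "bil = (\<lambda>d e x v v'. (\<Sum>\<theta>\<in>\<Theta>. d \<theta> * (A \<theta> x * form \<theta> v v')) + e * inner v v')"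
  have bilinear: "bilinear (bil d e x)" for d e x
    unfolding bilinear_def linear_iff bil_def form_def
    by (simp add: algebra_simps sum.distrib sum_distrib_left inner_add_left inner_add_right)
  \<comment> \<open>All blocks share the index type \<open>'n option\<close>; a scalar
    \<open>g i x\<close> is padded to a matrix with a single entry at
    \<open>(None, None)\<close>.\<close>
  define B :: "'i + (('i \<times> 'n \<times> 'n \<times> nat \<Rightarrow> real) \<times> real) \<Rightarrow> real ^ 'n \<Rightarrow> 'n option \<Rightarrow> 'n option \<Rightarrow> real" where
    "B = (\<lambda>k x a b. case k of Inl i \<Rightarrow> if a = None then if b = None then g i x else 0 else 0
      | Inr (d, e) \<Rightarrow> bil d e x (\<zeta> x a) (\<zeta> x b))"
  have B_Inl: "(\<Sum>a\<in>UNIV. \<Sum>b\<in>UNIV. z a * z b * B (Inl i) x a b) = (z None)\<^sup>2 * g i x" for z i x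
  proof -
    have "z a * z b * B (Inl i) x a b =
        (if a = None then if b = None then z None * z None * g i x else 0 else 0)" for a b
      by (simp add: B_def)
    moreover have "(\<Sum>b\<in>(UNIV :: 'n option set). if a = None then if b = None then z None * z None * g i x else 0 else 0) =
        (if a = None then z None * z None * g i x else 0)" for a :: "'n option"
      by (cases a) simp_all
    ultimately show ?thesis by (simp add: power2_eq_square)
  qed
  have B_Inr: "(\<Sum>a\<in>UNIV. \<Sum>b\<in>UNIV. z a * z b * B (Inr (d, e)) x a b) =
      bil d e x (\<Sum>a\<in>UNIV. z a *\<^sub>R \<zeta> x a) (\<Sum>a\<in>UNIV. z a *\<^sub>R \<zeta> x a)" for z d e x
    by (simp add: bilinear_sum[OF bilinear] sum.cartesian_product B_def bilinear_lmul[OF bilinear] bilinear_rmul[OF bilinear]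
        split_beta mult_ac)
  show ?thesis
  proof (rule SDP_representable_if_certified[where J = "I <+> D" and B = B])
    show "finite (I <+> D)" using finite_I D by simp
  next
    fix k x and z :: "'n option \<Rightarrow> real" assume k: "k \<in> I <+> D" and x: "x \<in> S"
    show "0 \<le> (\<Sum>a\<in>UNIV. \<Sum>b\<in>UNIV. z a * z b * B k x a b)"
    proof (cases k)
      case (Inl i)
      then have "0 \<le> g i x" using k x S_eq by auto
      then show ?thesis by (simp add: Inl B_Inl)
    next
      case (Inr de)
      then obtain d e where de: "k = Inr (d, e)" "(d, e) \<in> D" using k by (cases de) auto
      show ?thesis
        unfolding de(1) B_Inr bil_def using D_psd[OF de(2), of "(x, _)"] x by simp
    qed
  next
    fix P and y :: "real ^ 'n \<Rightarrow> real"
    assume P: "finite P" "P \<subseteq> S" and y: "sum y P = 1"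
      and lmi: "\<And>k z. k \<in> I <+> D \<Longrightarrow> 0 \<le> (\<Sum>p\<in>P. y p * (\<Sum>a\<in>UNIV. \<Sum>b\<in>UNIV. z a * z b * B k p a b))"
    define x where "x = (\<Sum>p\<in>P. y p *\<^sub>R p)"
    have g_nonneg: "0 \<le> (\<Sum>p\<in>P. y p * g i p)" if "i \<in> I" for i
      using lmi[OF InlI[OF that], of "\<lambda>_. 1"] unfolding B_Inl by simp
    have x_minus: "(\<Sum>p\<in>P. y p *\<^sub>R (p - u)) = x - u" for u
      by (simp add: x_def scaleR_diff_right sum_subtractf y flip: scaleR_sum_left)
    have gen_nonneg: "0 \<le> (\<Sum>p\<in>P. y p * bil d e p (p - u) (p - u))" if "(d, e) \<in> D" for d e u
    proof -
      \<comment> \<open>The choice \<open>t = 1\<close>, \<open>w = u\<close>.\<close>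
      define z where "z = case_option 1 (\<lambda>i. vec_nth u i)"
      have "(\<Sum>i\<in>UNIV. vec_nth u i *\<^sub>R axis i (1::real)) = u"
        using basis_expansion[of u] by (simp add: scalar_mult_eq_scaleR)
      then have "(\<Sum>a\<in>UNIV. z a *\<^sub>R \<zeta> p a) = p - u" for p
        by (simp add: UNIV_option_conv sum.reindex z_def \<zeta>_def sum_negf)
      then show ?thesis using lmi[OF InrI[OF that], of z] unfolding B_Inr by simp
    qed
    show "x \<in> S"
    proof (rule ccontr)
      assume "x \<notin> S"
      then obtain u \<mu> where k: "KKT u \<mu>" and neg: "inner (\<Sum>i\<in>I. \<mu> i *\<^sub>R gradient (g i) u) (x - u) < 0"
        by (rule separating_KKT)
      let ?l = "\<Sum>i\<in>I. \<mu> i *\<^sub>R gradient (g i) u"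
      \<comment> \<open>\<open>a\<close> and \<open>b\<close> are the values of the functional given
        by the weights \<open>y\<close> on the basic forms and on the squared norm, both with
        argument \<open>p - u\<close>.\<close>
      define a where "a = (\<lambda>\<theta>. \<Sum>p\<in>P. y p * (A \<theta> p * form \<theta> (p - u) (p - u)))"
      define b where "b = (\<Sum>p\<in>P. y p * inner (p - u) (p - u))"
      have swap: "(\<Sum>\<theta>\<in>\<Theta>. d \<theta> * a \<theta>) = (\<Sum>p\<in>P. y p * (\<Sum>\<theta>\<in>\<Theta>. d \<theta> * (A \<theta> p * form \<theta> (p - u) (p - u))))" for d
        by (simp add: a_def sum_distrib_left sum.swap[of _ P] mult_ac)
      have "0 \<le> (\<Sum>\<theta>\<in>\<Theta>. d \<theta> * a \<theta>) + e * b" if "(d, e) \<in> D" for d e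
        using gen_nonneg[OF that, of u] unfolding swap b_def
        by (simp add: bil_def distrib_left sum.distrib sum_distrib_left mult_ac)
      moreover have "(\<lambda>\<theta>. c \<theta> (u, \<mu>)) \<in> (\<lambda>p \<theta>. c \<theta> p) ` K" using k by (auto simp: K_def)
      \<comment> \<open>The generators were fixed before \<open>u\<close> was known; the cone
        property makes the functional nonnegative on the remainder of this particular pair.
        Substituting \<open>remainder_eq\<close> at each point of \<open>P\<close> then contradicts
        the separation.\<close>
      ultimately have "0 \<le> (\<Sum>\<theta>\<in>\<Theta>. c \<theta> (u, \<mu>) * a \<theta>)" by (intro D_cone)
      also have "\<dots> = (\<Sum>p\<in>P. y p * Q (u, \<mu>) p (p - u))" unfolding swap Q_def ..
      also have "\<dots> = (\<Sum>p\<in>P. y p * (inner ?l (p - u) - (\<Sum>i\<in>I. \<mu> i * g i p)))"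
        using remainder_eq[OF k Q_int] by simp
      also have "\<dots> = inner ?l (\<Sum>p\<in>P. y p *\<^sub>R (p - u)) - (\<Sum>i\<in>I. \<mu> i * (\<Sum>p\<in>P. y p * g i p))"
        by (simp add: right_diff_distrib sum_subtractf inner_sum_right sum_distrib_left sum.swap[of _ P] mult_ac)
      also have "\<dots> \<le> inner ?l (x - u)"
        using k g_nonneg unfolding x_minus KKT_def by (simp add: sum_nonneg)
      finally show False using neg by simp
    qed
  qed
qed

end

section \<open>Reduction to constraints with a Slater point\<close>

theorem theorem1:
  fixes g :: "nat \<Rightarrow> real ^ 'n::finite \<Rightarrow> real" and m :: nat and S :: "(real ^ 'n) set"
  assumes poly: "\<And>i. i \<in> {1..m} \<Longrightarrow> real_polynomial_function (g i)"
    and S_def: "S = semialg_set m g"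
    and "compact S" and "convex S" and "interior S \<noteq> {}"
    and conc: "\<And>i. i \<in> {1..m} \<Longrightarrow> concave_on S (g i)"
    and pdlh: "PDLH m g"
  shows "SDP_representable S"
proof -
  obtain x0 where x0: "x0 \<in> interior S" using \<open>interior S \<noteq> {}\<close> by blast
  then have x0S: "x0 \<in> S" using interior_subset by blast
  define I where "I = {i \<in> {1..m}. 0 < g i x0}"
  have I: "finite I" "I \<subseteq> {1..m}" by (auto simp: I_def)
  \<comment> \<open>A constraint that is 0 at the interior point \<open>x0\<close> is the zero
    polynomial. The segment from \<open>y\<close> to \<open>x0\<close> can be prolonged inside
    \<open>S\<close>; feasibility there and the tangent inequality at \<open>x0\<close> determine
    the sign of the slope, which forces \<open>g i y \<le> 0\<close>. Hence \<open>x0\<close> is a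
    Slater point of the remaining constraints, which still describe \<open>S\<close>.\<close>
  have zero: "g i x = 0" if i: "i \<in> {1..m}" "i \<notin> I" for i x
  proof -
    have 0: "g i x0 = 0" using i x0S by (auto simp: I_def S_def semialg_set_def not_less intro: order_antisym)
    have "g i y = 0" if y: "y \<in> S" for y
    proof -
      obtain e where e: "e > 0" "\<And>t. 0 < t \<Longrightarrow> t < e \<Longrightarrow> x0 + t *\<^sub>R (x0 - y) \<in> interior S"
        using interior_contains_segment_start[OF x0] by blast
      then have z: "x0 + (e / 2) *\<^sub>R (x0 - y) \<in> S" using interior_subset by (metis field_sum_of_halves half_gt_zero less_add_same_cancel1 subsetD)
      then have "0 \<le> g i (x0 + (e / 2) *\<^sub>R (x0 - y))" using i by (simp add: S_def semialg_set_def)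
      also have "\<dots> \<le> (e / 2) * inner (gradient (g i) x0) (x0 - y)"
        using concave_on_le_tangent[OF poly[OF i(1)] conc[OF i(1)] x0S z] 0 by simp
      finally have "0 \<le> inner (gradient (g i) x0) (x0 - y)" using e(1) by (simp add: zero_le_mult_iff)
      moreover have "g i y \<le> g i x0 + inner (gradient (g i) x0) (y - x0)"
        by (rule concave_on_le_tangent[OF poly[OF i(1)] conc[OF i(1)] x0S y])
      ultimately have "g i y \<le> 0" using 0 by (simp add: inner_diff_right)
      moreover have "0 \<le> g i y" using y i by (simp add: S_def semialg_set_def)
      ultimately show ?thesis by simp
    qed
    then show ?thesis by (rule real_polynomial_function_eq_0[OF poly[OF i(1)] x0])
  qed
  interpret pd_convex_program I g S x0
  proof
    show "S = {x. \<forall>i\<in>I. 0 \<le> g i x}"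
      using zero I(2) by (force simp: S_def semialg_set_def)
    show conc': "concave_on S (g i)" if "i \<in> I" for i using that conc I(2) by blast
    fix u \<mu> and v :: "real ^ 'n"
    assume u: "u \<in> S" and \<mu>: "\<forall>i\<in>I. 0 \<le> \<mu> i" "\<forall>i\<in>I. \<mu> i * g i u = 0"
      and l: "(\<Sum>i\<in>I. \<mu> i *\<^sub>R gradient (g i) u) \<noteq> 0" and v: "v \<noteq> 0"
    \<comment> \<open>Extension by zero turns multipliers over \<open>I\<close> into multipliers
      over \<open>{1..m}\<close>, as PDLH expects them.\<close>
    define \<nu> where "\<nu> = (\<lambda>i. if i \<in> I then \<mu> i else 0)"
    let ?l = "\<Sum>i\<in>I. \<mu> i *\<^sub>R gradient (g i) u"
    have eq: "?l = (\<Sum>i=1..m. \<nu> i *\<^sub>R gradient (g i) u)"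
      using I by (intro sum.mono_neutral_cong_left) (auto simp: \<nu>_def)
    have "lagrange_multipliers m g ?l u \<nu>"
      unfolding lagrange_multipliers_def using eq \<mu> by (auto simp: \<nu>_def)
    \<comment> \<open>PDLH speaks of minimizers. By the tangent inequalities and complementarity, a
      KKT point of a concave system is one.\<close>
    moreover have "inner ?l u \<le> inner ?l y" if y: "y \<in> S" for y
    proof -
      have "0 \<le> \<mu> i * inner (gradient (g i) u) (y - u)" if i: "i \<in> I" for i
      proof -
        have "0 \<le> \<mu> i * g i y" using \<mu>(1) i y I(2) by (auto simp: S_def semialg_set_def)
        also have "\<dots> \<le> \<mu> i * (g i u + inner (gradient (g i) u) (y - u))"
          using \<mu>(1) i I(2) by (intro mult_left_mono concave_on_le_tangent[OF poly conc' u y]) auto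
        also have "\<dots> = \<mu> i * inner (gradient (g i) u) (y - u)"
          using bspec[OF \<mu>(2) i] by (simp only: distrib_left)
        finally show ?thesis .
      qed
      then have "0 \<le> inner ?l (y - u)" by (simp add: inner_sum_left sum_nonneg)
      then show ?thesis by (simp add: inner_diff_right)
    qed
    then have "is_arg_min (inner ?l) (\<lambda>x. x \<in> semialg_set m g) u"
      using u unfolding is_arg_min_def S_def[symmetric] by (auto simp: not_less)
    ultimately have "pos_def (- (\<Sum>i=1..m. \<nu> i *\<^sub>R hessian (g i) u))"
      using pdlh l unfolding PDLH_def by blast
    then have "0 < inner v ((- (\<Sum>i=1..m. \<nu> i *\<^sub>R hessian (g i) u)) *v v)"
      using v by (simp add: pos_def_def)
    moreover have "(\<Sum>i=1..m. \<nu> i *\<^sub>R hessian (g i) u) = (\<Sum>i\<in>I. \<mu> i *\<^sub>R hessian (g i) u)"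
      using I by (intro sum.mono_neutral_cong_right) (auto simp: \<nu>_def)
    moreover have "(- (\<Sum>i\<in>I. \<mu> i *\<^sub>R hessian (g i) u)) *v v = - (\<Sum>i\<in>I. \<mu> i *\<^sub>R (hessian (g i) u *v v))"
    proof -
      interpret L: linear "\<lambda>A :: real ^ 'n ^ 'n. A *v v"
        by (simp add: linear_iff matrix_vector_mult_add_rdistrib scaleR_matrix_vector_assoc)
      show ?thesis by (simp only: L.neg L.sum L.scale)
    qed
    ultimately show "(\<Sum>i\<in>I. \<mu> i * inner v (hessian (g i) u *v v)) < 0"
      by (simp add: inner_sum_right)
  qed (use assms I x0S in \<open>auto simp: I_def\<close>)
  show ?thesis by (rule SDP_representable_feasible_set)
qed

end
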